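(* Let $r\ge1$ be an integer, let $A\colon[0,+\infty)\to M_n(\mathbb{R})$ and $f\colon[0,+\infty)\times\mathbb{R}^n\to\mathbb{R}^n$ be continuous, and consider the systems $$\text{(L)}\ \ \dot x=A(t)x,\qquad \text{(N)}\ \ \dot y=A(t)y+f(t,y),\qquad t\ge0.$$ Let $X(t,s)$ be the transition matrix of (L) and assume: (A1) $\sup_{t\ge0}\|A(t)\|=M<+\infty$; (A2) there is $\mu>0$ with $|f(t,y)|\le\mu$ for all $t\ge0$, $y\in\mathbb{R}^n$; (A3) there is $\gamma>0$ with $|f(t,y)-f(t,y')|\le\gamma|y-y'|$ for all $t\ge0$, $y,y'\in\mathbb{R}^n$; (A4) (L) has an exponential dichotomy on $[0,+\infty)$ with projection $P=I$ and constants $K,\alpha>0$, that is, $\|X(t,s)\|\le Ke^{-\alpha(t-s)}$ for all $t\ge s\ge0$, and $2K\gamma<\alpha$; (D4) $f(t,x)$ and its derivatives with respect to $x$ up to order $r$ are continuous functions of $(t,x)$. Then (L) and (N) are $C^r$ continuously topologically equivalent on $\mathbb{R}^+=[0,+\infty)$.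
   Context: $|\cdot|$ is a norm on $\mathbb{R}^n$ and $\|\cdot\|$ the induced operator norm. The transition matrix is $X(t,s)=X(t)X^{-1}(s)$ for a fundamental matrix $X(t)$. Definition 1. For an interval $J\subseteq\mathbb{R}$, the systems (L) and (N) are $J$-continuously topologically equivalent if there exists $H\colon J\times\mathbb{R}^n\to\mathbb{R}^n$ such that: (i) if $t\mapsto x(t)$ is a solution of (L), then $t\mapsto H(t,x(t))$ is a solution of (N); (ii) $H(t,u)-u$ is bounded on $J\times\mathbb{R}^n$; (iii) for each fixed $t\in J$, $u\mapsto H(t,u)$ is a homeomorphism of $\mathbb{R}^n$; (iv) $H$ is continuous at every $(t,u)\in J\times\mathbb{R}^n$; and, in addition, the function $G$ defined by letting $G(t,\cdot)$ be the inverse of $H(t,\cdot)$ has properties (ii)–(iv) and maps solutions of (N) into solutions of (L). Definition 2. The systems (L) and (N) are $C^r$ continuously topologically equivalent on $J$ if they are $J$-continuously topologically equivalent (with maps $H$, $G$ as in Definition 1) and: for any fixed $t\in J$ the map $u\mapsto H(t,u)$ is a $C^r$-diffeomorphism of $\mathbb{R}^n$; and the partial derivatives of $H$ and $G$ with respect to $u$ up to order $r$ are continuous functions of $(t,u)\in J\times\mathbb{R}^n$. *)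

theory Defs
  imports "HOL-Analysis.Analysis"
begin

definition is_norm :: "(real ^ 'n \<Rightarrow> real) \<Rightarrow> bool" where
  "is_norm nm \<longleftrightarrow>
     (\<forall>x. 0 \<le> nm x) \<and> (\<forall>x. nm x = 0 \<longleftrightarrow> x = 0) \<and>
     (\<forall>c x. nm (c *\<^sub>R x) = \<bar>c\<bar> * nm x) \<and>
     (\<forall>x y. nm (x + y) \<le> nm x + nm y)"

text \<open>Same shape as the library's \<^const>\<open>onorm\<close>, which is tied to the Euclidean norm of
  \<^typ>\<open>real ^ 'n\<close>; the term at \<open>x = 0\<close> is \<open>0 / 0 = 0\<close>.\<close>

definition operator_norm :: "(real ^ 'n \<Rightarrow> real) \<Rightarrow> real ^ 'n ^ 'n \<Rightarrow> real" where
  "operator_norm nm B = (SUP x. nm (B *v x) / nm x)"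

text \<open>A time-dependent vector field \<open>F\<close> stands for the system \<open>x' = F(t, x)\<close>. Only times in \<open>J\<close>
  matter, and derivatives at an end point of \<open>J\<close> are one-sided.\<close>

definition is_solution ::
  "real set \<Rightarrow> (real \<Rightarrow> real ^ 'n \<Rightarrow> real ^ 'n) \<Rightarrow> (real \<Rightarrow> real ^ 'n) \<Rightarrow> bool" where
  "is_solution J F x \<longleftrightarrow> (\<forall>t\<in>J. (x has_vector_derivative F t (x t)) (at t within J))"

definition linear_system ::
  "(real \<Rightarrow> real ^ 'n ^ 'n) \<Rightarrow> real \<Rightarrow> real ^ 'n \<Rightarrow> real ^ 'n" where
  "linear_system A t x = A t *v x"

definition perturbed_system ::
  "(real \<Rightarrow> real ^ 'n ^ 'n) \<Rightarrow> (real \<Rightarrow> real ^ 'n \<Rightarrow> real ^ 'n) \<Rightarrow> real \<Rightarrow> real ^ 'n \<Rightarrow> real ^ 'n" where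
  "perturbed_system A f t y = A t *v y + f t y"

definition fundamental_matrix ::
  "real set \<Rightarrow> (real \<Rightarrow> real ^ 'n ^ 'n) \<Rightarrow> (real \<Rightarrow> real ^ 'n ^ 'n) \<Rightarrow> bool" where
  "fundamental_matrix J A \<Phi> \<longleftrightarrow>
     (\<forall>t\<in>J. (\<Phi> has_vector_derivative A t ** \<Phi> t) (at t within J) \<and> invertible (\<Phi> t))"

definition transition_matrix ::
  "(real \<Rightarrow> real ^ 'n ^ 'n) \<Rightarrow> real \<Rightarrow> real \<Rightarrow> real ^ 'n ^ 'n" where
  "transition_matrix \<Phi> t s = \<Phi> t ** matrix_inv (\<Phi> s)"

text \<open>Boundedness, continuity and differentiability do not depend on the norm chosen on
  \<open>R^n\<close>, so the library notions are used.\<close>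

definition near_identity_homeo :: "real set \<Rightarrow> (real \<Rightarrow> real ^ 'n \<Rightarrow> real ^ 'n) \<Rightarrow> bool" where
  "near_identity_homeo J H \<longleftrightarrow>
     bounded ((\<lambda>(t, u). H t u - u) ` (J \<times> UNIV)) \<and>
     (\<forall>t\<in>J. \<exists>g. homeomorphism UNIV UNIV (H t) g) \<and>
     continuous_on (J \<times> UNIV) (\<lambda>(t, u). H t u)"

definition maps_solutions ::
  "real set \<Rightarrow> (real \<Rightarrow> real ^ 'n \<Rightarrow> real ^ 'n) \<Rightarrow> (real \<Rightarrow> real ^ 'n \<Rightarrow> real ^ 'n) \<Rightarrow>
   (real \<Rightarrow> real ^ 'n \<Rightarrow> real ^ 'n) \<Rightarrow> bool" where
  "maps_solutions J F1 F2 H \<longleftrightarrow>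
     (\<forall>x. is_solution J F1 x \<longrightarrow> is_solution J F2 (\<lambda>t. H t (x t)))"

definition topological_equivalence ::
  "real set \<Rightarrow> (real \<Rightarrow> real ^ 'n \<Rightarrow> real ^ 'n) \<Rightarrow> (real \<Rightarrow> real ^ 'n \<Rightarrow> real ^ 'n) \<Rightarrow>
   (real \<Rightarrow> real ^ 'n \<Rightarrow> real ^ 'n) \<Rightarrow> (real \<Rightarrow> real ^ 'n \<Rightarrow> real ^ 'n) \<Rightarrow> bool" where
  "topological_equivalence J F1 F2 H G \<longleftrightarrow>
     maps_solutions J F1 F2 H \<and> near_identity_homeo J H \<and>
     (\<forall>t\<in>J. G t = inv (H t)) \<and>
     maps_solutions J F2 F1 G \<and> near_identity_homeo J G"

definition has_partial_derivative ::
  "(real ^ 'n \<Rightarrow> real ^ 'n) \<Rightarrow> 'n \<Rightarrow> (real ^ 'n \<Rightarrow> real ^ 'n) \<Rightarrow> bool" where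
  "has_partial_derivative g i D \<longleftrightarrow>
     (\<forall>u. ((\<lambda>h. g (u + h *\<^sub>R axis i 1)) has_vector_derivative D u) (at 0))"

text \<open>\<open>C_map r g\<close>: all iterated partial derivatives of \<open>g\<close> of order at most \<open>r\<close>, taken in any order
  of the coordinates, exist everywhere and are continuous.\<close>

primrec C_map :: "nat \<Rightarrow> (real ^ 'n \<Rightarrow> real ^ 'n) \<Rightarrow> bool" where
  "C_map 0 g \<longleftrightarrow> continuous_on UNIV g"
| "C_map (Suc r) g \<longleftrightarrow>
     continuous_on UNIV g \<and> (\<forall>i. \<exists>D. has_partial_derivative g i D \<and> C_map r D)"

definition C_diffeomorphism :: "nat \<Rightarrow> (real ^ 'n \<Rightarrow> real ^ 'n) \<Rightarrow> bool" where
  "C_diffeomorphism r g \<longleftrightarrow> bij g \<and> C_map r g \<and> C_map r (inv g)"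

text \<open>The iterated partial derivatives of \<open>F t u\<close> with respect to \<open>u\<close> only, of order at most \<open>r\<close>,
  exist and are jointly continuous in \<open>(t, u)\<close>; no derivative in \<open>t\<close> is taken.\<close>

primrec space_derivs_continuous ::
  "nat \<Rightarrow> real set \<Rightarrow> (real \<Rightarrow> real ^ 'n \<Rightarrow> real ^ 'n) \<Rightarrow> bool" where
  "space_derivs_continuous 0 J F \<longleftrightarrow> continuous_on (J \<times> UNIV) (\<lambda>(t, u). F t u)"
| "space_derivs_continuous (Suc r) J F \<longleftrightarrow>
     continuous_on (J \<times> UNIV) (\<lambda>(t, u). F t u) \<and>
     (\<forall>i. \<exists>D. (\<forall>t\<in>J. has_partial_derivative (F t) i (D t)) \<and> space_derivs_continuous r J D)"

definition C_continuously_topologically_equivalent ::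
  "nat \<Rightarrow> real set \<Rightarrow> (real \<Rightarrow> real ^ 'n \<Rightarrow> real ^ 'n) \<Rightarrow> (real \<Rightarrow> real ^ 'n \<Rightarrow> real ^ 'n) \<Rightarrow> bool" where
  "C_continuously_topologically_equivalent r J F1 F2 \<longleftrightarrow>
     is_interval J \<and>
     (\<exists>H G. topological_equivalence J F1 F2 H G \<and>
        (\<forall>t\<in>J. C_diffeomorphism r (H t)) \<and>
        space_derivs_continuous r J H \<and> space_derivs_continuous r J G)"

end

theory Submission
  imports Defs
begin

text \<open>Let \<open>Y\<^sub>t\<close> and \<open>Y'\<^sub>t\<close> be the flows of (L) and (N) from time \<open>0\<close> to time \<open>t\<close>. Since the dichotomy has
  projection \<open>I\<close>, solutions of (L) and (N) with the same initial value stay within distance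
  \<open>K \<mu> / \<alpha>\<close> of each other, by variation of constants. Hence \<open>H\<^sub>t = Y'\<^sub>t \<circ> Y\<^sub>t\<^sup>-\<^sup>1\<close>, with inverse
  \<open>G\<^sub>t = Y\<^sub>t \<circ> Y'\<^sub>t\<^sup>-\<^sup>1\<close>, is the required equivalence, once both flows and their inverses are known to
  be of class \<open>C\<^sup>r\<close> in space, jointly continuously in time. For this a solution of a linear equation
  with parameters is shown to be as smooth as its coefficients: its difference quotients solve a
  linear equation again, so their limits exist by continuous dependence on parameters. The Jacobian
  of a flow and the inverse of that Jacobian both solve such an equation, with coefficients given by
  the flow itself, and one order of differentiability is gained at each step of an induction.\<close>

section \<open>Lipschitz differential equations depending on a parameter\<close>

text \<open>One Lipschitz constant \<open>L\<close>, uniform in time, serves a field and all its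
  linearisations: the derivative of an \<open>L\<close>-Lipschitz map has norm at most
  \<open>L\<close>, and so have its averages along segments and its transpose. A single global
  existence theorem with a parameter therefore covers the flow, its Jacobian, the adjoint equation
  and the difference quotients, without continuation arguments. The obstacle is the quotient at step
  size \<open>h = 0\<close>. Writing an increment as an integral of the derivative along a segment
  (Hadamard's lemma) makes the coefficients of its equation continuous up to \<open>h = 0\<close>,
  so that differentiability becomes plain continuity in the parameter \<open>h\<close>. For the
  inverse, the same Lipschitz bound run backwards in time makes the time-\<open>t\<close> map
  bijective with Lipschitz inverse, and the solutions of the adjoint equation form the inverse
  Jacobian. The conjugacy is anchored at time \<open>0\<close> because a solution is determined by
  its value there.\<close>

lemma continuous_on_integral_to:
  fixes g :: "real \<Rightarrow> 'p::topological_space \<Rightarrow> 'b::banach"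
  assumes g: "continuous_on ({0..} \<times> UNIV) (\<lambda>(t, p). g t p)"
  shows "continuous_on ({0..} \<times> UNIV) (\<lambda>(t, p). integral {0..t} (\<lambda>s. g s p))"
proof -
  \<comment> \<open>Rescaling moves the variable end point into the integrand, so that
    \<open>t\<close> becomes one more parameter of an integral over a fixed interval.\<close>
  have eq: "integral {0..t} (\<lambda>s. g s p) = t *\<^sub>R integral {0..1} (\<lambda>s. g (t * s) p)" if "t \<ge> 0" for t p
  proof (cases "t = 0")
    case False
    with that have t: "t > 0" by simp
    have "continuous_on {0..t} (\<lambda>s. g s p)"
      by (rule continuous_on_compose2[OF g, of _ "\<lambda>s. (s, p)", simplified]) (auto intro!: continuous_intros)
    then have "((\<lambda>s. g s p) has_integral integral {0..t} (\<lambda>s. g s p)) {0..t}"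
      by (rule integrable_integral[OF integrable_continuous_real])
    from has_integral_stretch_real[OF this, of t] False
    have "((\<lambda>s. g (t * s) p) has_integral (1 / t) *\<^sub>R integral {0..t} (\<lambda>s. g s p)) ((\<lambda>x. x / t) ` {0..t})"
      using t by simp
    moreover have "(\<lambda>x. x / t) ` {0..t} = {0..1}"
    proof (intro set_eqI iffI)
      fix x assume "x \<in> {0..1::real}"
      then show "x \<in> (\<lambda>x. x / t) ` {0..t}" using t by (intro image_eqI[of _ _ "x * t"]) auto
    qed (use t in auto)
    ultimately show ?thesis using t by (simp add: integral_unique)
  qed simp
  have "continuous_on ({0..} \<times> UNIV)
     (\<lambda>x::real \<times> 'p. integral (cbox 0 1) (\<lambda>s. g (fst x * s) (snd x)))"
  proof (rule integral_continuous_on_param)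
    have "continuous_on (({0..} \<times> (UNIV::'p set)) \<times> cbox 0 (1::real)) (\<lambda>z. case (fst (fst z) * snd z, snd (fst z)) of (t, p) \<Rightarrow> g t p)"
      by (rule continuous_on_compose2[OF g, of _ "\<lambda>z. (fst (fst z) * snd z, snd (fst z))"])
        (auto intro!: continuous_intros)
    then show "continuous_on (({0..} \<times> (UNIV::'p set)) \<times> cbox 0 (1::real)) (\<lambda>(x, s). g (fst x * s) (snd x))"
      by (simp add: case_prod_unfold)
  qed
  then have "continuous_on ({0..} \<times> UNIV)
     (\<lambda>x::real \<times> 'p. fst x *\<^sub>R integral {0..1} (\<lambda>s. g (fst x * s) (snd x)))"
    by (intro continuous_intros) (auto simp: cbox_interval)
  then show ?thesis
    by (rule continuous_on_eq) (auto simp: eq)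
qed

lemma at_within_atLeast:
  fixes t :: real
  assumes "0 \<le> t" "t < T"
  shows "at t within {0..} = at t within {0..T}"
  by (rule at_within_nhd[of _ "{..<T}"]) (use assms in auto)

lemma integral_has_vector_derivative_atLeast:
  fixes g :: "real \<Rightarrow> 'b::banach"
  assumes g: "continuous_on {0..} g" and t: "t \<ge> 0"
  shows "((\<lambda>t. integral {0..t} g) has_vector_derivative g t) (at t within {0..})"
proof -
  have "((\<lambda>t. integral {0..t} g) has_vector_derivative g t) (at t within {0..t+1})"
    by (rule integral_has_vector_derivative[OF continuous_on_subset[OF g]]) (use t in auto)
  then show ?thesis using at_within_atLeast[of t "t + 1"] t by simp
qed

lemma continuous_on_time_slice:
  assumes "continuous_on (J \<times> UNIV) (\<lambda>(t, p). g t p)" "T \<subseteq> J"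
  shows "continuous_on T (\<lambda>t. g t p)"
  by (rule continuous_on_compose2[OF assms(1), of _ "\<lambda>t. (t, p)", simplified])
    (use assms(2) in \<open>auto intro!: continuous_intros\<close>)

lemma is_solution_continuous_on:
  assumes "is_solution J F x" shows "continuous_on J x"
  using assms unfolding is_solution_def continuous_on_eq_continuous_within
  by (meson has_vector_derivative_continuous)

lemma is_solution_cong:
  assumes "\<And>t. t \<in> J \<Longrightarrow> x t = y t"
  shows "is_solution J F x \<longleftrightarrow> is_solution J F y"
proof -
  have "(x has_vector_derivative F t (x t)) (at t within J) \<longleftrightarrow>
     (y has_vector_derivative F t (y t)) (at t within J)" if "t \<in> J" for t
    using assms that has_vector_derivative_transform by metis
  then show ?thesis by (simp add: is_solution_def)
qed

text \<open>The derivative of the squared distance \<open>d\<close> is at most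
  \<open>2 * L * d\<close> in absolute value, so \<open>exp (- 2 * L * t) * d t\<close> decreases
  and \<open>exp (2 * L * t) * d t\<close> increases. The second estimate, a Gronwall bound
  backwards in time, later makes the flow injective and its inverse Lipschitz.\<close>

lemma lipschitz_solutions_separation:
  fixes F :: "real \<Rightarrow> real ^ 'n \<Rightarrow> real ^ 'n"
  assumes lip: "\<And>t x y. t \<ge> 0 \<Longrightarrow> norm (F t x - F t y) \<le> L * norm (x - y)"
    and x: "is_solution {0..} F x" and y: "is_solution {0..} F y" and t: "t \<ge> 0"
  shows "norm (x t - y t) \<le> exp (L * t) * norm (x 0 - y 0)"
    and "norm (x 0 - y 0) \<le> exp (L * t) * norm (x t - y t)"
proof -
  define d where "d s = (x s - y s) \<bullet> (x s - y s)" for s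
  define e where "e s = 2 * ((x s - y s) \<bullet> (F s (x s) - F s (y s)))" for s
  have dd: "(d has_real_derivative e s) (at s)" if "s > 0" for s
  proof -
    have at: "at s within {0..} = at s" using that by (intro at_within_interior) auto
    have "(x has_vector_derivative F s (x s)) (at s)" "(y has_vector_derivative F s (y s)) (at s)"
      using x y that unfolding is_solution_def at[symmetric] by simp_all
    then have "((\<lambda>s. x s - y s) has_vector_derivative F s (x s) - F s (y s)) (at s)"
      by (intro derivative_intros)
    then have *: "((\<lambda>s. x s - y s) has_derivative (\<lambda>h. h *\<^sub>R (F s (x s) - F s (y s)))) (at s)"
      by (simp add: has_vector_derivative_def)
    show ?thesis
      unfolding d_def e_def has_field_derivative_def
      by (rule has_derivative_eq_rhs[OF has_derivative_inner[OF * *]]) (simp add: fun_eq_iff inner_commute)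
  qed
  have e: "\<bar>e s\<bar> \<le> 2 * L * d s" if "s \<ge> 0" for s
  proof -
    have "\<bar>(x s - y s) \<bullet> (F s (x s) - F s (y s))\<bar> \<le> norm (x s - y s) * norm (F s (x s) - F s (y s))"
      by (rule Cauchy_Schwarz_ineq2)
    also have "\<dots> \<le> norm (x s - y s) * (L * norm (x s - y s))"
      by (intro mult_left_mono lip that) auto
    finally show ?thesis
      unfolding e_def d_def abs_mult power2_norm_eq_inner[symmetric] by (simp add: power2_eq_square mult_ac)
  qed
  have dc: "continuous_on {0..t} d"
    unfolding d_def by (intro continuous_intros continuous_on_subset[OF is_solution_continuous_on[OF x]]
        continuous_on_subset[OF is_solution_continuous_on[OF y]]) auto
  have mono: "exp (- c * 0) * d 0 \<le> exp (- c * t) * d t" if c: "\<And>s. s > 0 \<Longrightarrow> c * d s \<le> e s" for c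
  proof (rule DERIV_nonneg_imp_increasing_open[OF t])
    fix s assume s: "0 < s" "s < t"
    have "((\<lambda>s. exp (- c * s) * d s) has_real_derivative exp (- c * s) * (e s - c * d s)) (at s)"
      using dd[OF s(1)] by (auto intro!: derivative_eq_intros simp: algebra_simps)
    moreover have "0 \<le> exp (- c * s) * (e s - c * d s)" using c[OF s(1)] by simp
    ultimately show "\<exists>y. ((\<lambda>s. exp (- c * s) * d s) has_real_derivative y) (at s) \<and> 0 \<le> y" by blast
  qed (intro continuous_intros dc)
  have mono': "exp (- c * t) * d t \<le> exp (- c * 0) * d 0" if c: "\<And>s. s > 0 \<Longrightarrow> e s \<le> c * d s" for c
  proof (rule DERIV_nonpos_imp_decreasing_open[OF t])
    fix s assume s: "0 < s" "s < t"
    have "((\<lambda>s. exp (- c * s) * d s) has_real_derivative exp (- c * s) * (e s - c * d s)) (at s)"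
      using dd[OF s(1)] by (auto intro!: derivative_eq_intros simp: algebra_simps)
    moreover have "exp (- c * s) * (e s - c * d s) \<le> 0" using c[OF s(1)] by (simp add: mult_nonneg_nonpos)
    ultimately show "\<exists>y. ((\<lambda>s. exp (- c * s) * d s) has_real_derivative y) (at s) \<and> y \<le> 0" by blast
  qed (intro continuous_intros dc)
  have sq: "(exp (L * t))\<^sup>2 = exp (2 * L * t)" by (simp add: exp_double[symmetric] mult.assoc)
  have d: "d s = (norm (x s - y s))\<^sup>2" for s by (simp add: d_def power2_norm_eq_inner)
  have "exp (- (2 * L) * t) * d t \<le> exp (- (2 * L) * 0) * d 0"
    by (rule mono') (use e in \<open>force simp: abs_le_iff\<close>)
  then have "(norm (x t - y t))\<^sup>2 \<le> (exp (L * t) * norm (x 0 - y 0))\<^sup>2"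
    by (simp add: power_mult_distrib sq d exp_minus field_simps)
  then show "norm (x t - y t) \<le> exp (L * t) * norm (x 0 - y 0)"
    by (rule power2_le_imp_le) simp
  have "exp (- (- 2 * L) * 0) * d 0 \<le> exp (- (- 2 * L) * t) * d t"
  proof (rule mono)
    show "- 2 * L * d s \<le> e s" if "s > 0" for s using e[of s] that by (simp add: abs_le_iff)
  qed
  then have "(norm (x 0 - y 0))\<^sup>2 \<le> (exp (L * t) * norm (x t - y t))\<^sup>2"
    by (simp add: power_mult_distrib sq d)
  then show "norm (x 0 - y 0) \<le> exp (L * t) * norm (x t - y t)"
    by (rule power2_le_imp_le) simp
qed

corollary lipschitz_solution_unique:
  fixes F :: "real \<Rightarrow> real ^ 'n \<Rightarrow> real ^ 'n"
  assumes "\<And>t x y. t \<ge> 0 \<Longrightarrow> norm (F t x - F t y) \<le> L * norm (x - y)"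
    and "is_solution {0..} F x" "is_solution {0..} F y" "x 0 = y 0" "t \<ge> 0"
  shows "x t = y t"
  using lipschitz_solutions_separation(1)[OF assms(1-3,5)] assms(4) by simp

section \<open>Picard iteration with a parameter\<close>

primrec picard ::
  "('p \<Rightarrow> real \<Rightarrow> real ^ 'n \<Rightarrow> real ^ 'n) \<Rightarrow> ('p \<Rightarrow> real ^ 'n) \<Rightarrow> nat \<Rightarrow> real \<Rightarrow> 'p \<Rightarrow> real ^ 'n" where
  "picard F c 0 t p = c p"
| "picard F c (Suc k) t p = c p + integral {0..t} (\<lambda>s. F p s (picard F c k s p))"

lemma continuous_on_nonautonomous_field:
  fixes F :: "'p::topological_space \<Rightarrow> real \<Rightarrow> 'b::topological_space \<Rightarrow> 'c::topological_space"
  assumes F: "continuous_on ({0..} \<times> UNIV) (\<lambda>(t, p, x). F p t x)"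
    and y: "continuous_on ({0..} \<times> UNIV) (\<lambda>(t, p). y t p)"
  shows "continuous_on ({0..} \<times> UNIV) (\<lambda>(t, p). F p t (y t p))"
proof -
  have "continuous_on ({0..} \<times> UNIV) (\<lambda>z::real \<times> 'p. case (fst z, snd z, case z of (t, p) \<Rightarrow> y t p) of (t, p, x) \<Rightarrow> F p t x)"
    by (rule continuous_on_compose2[OF F]) (auto intro!: continuous_intros y)
  then show ?thesis by (simp add: case_prod_unfold)
qed

lemma integral_exp_le:
  fixes L :: real
  assumes "L > 0" "t \<ge> 0"
  shows "integral {0..t} (\<lambda>s. exp (L * s)) \<le> exp (L * t) / L"
proof -
  have "((\<lambda>s. exp (L * s)) has_integral exp (L * t) / L - exp (L * 0) / L) {0..t}"
    by (rule fundamental_theorem_of_calculus[OF assms(2)])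
      (use assms in \<open>auto intro!: derivative_eq_intros
        simp: has_real_derivative_iff_has_vector_derivative[symmetric]\<close>)
  then show ?thesis using assms by (simp add: integral_unique)
qed

text \<open>Measured with the weight \<open>exp (2 * L * t)\<close>, each Picard step halves the
  distance of consecutive iterates, which gives geometric convergence on every bounded time
  interval. Convergence is uniform on compact parameter balls, so the solution is jointly continuous
  in time and parameter.\<close>

proposition lipschitz_ode_exists:
  fixes F :: "'p::euclidean_space \<Rightarrow> real \<Rightarrow> real ^ 'n \<Rightarrow> real ^ 'n"
  assumes F: "continuous_on ({0..} \<times> UNIV) (\<lambda>(t, p, x). F p t x)"
    and lip: "\<And>p t x y. t \<ge> 0 \<Longrightarrow> norm (F p t x - F p t y) \<le> L * norm (x - y)"
    and L: "L > 0" and c: "continuous_on UNIV c"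
  shows "\<exists>y. continuous_on ({0..} \<times> UNIV) (\<lambda>(t, p). y t p) \<and>
    (\<forall>p. y 0 p = c p \<and> is_solution {0..} (F p) (\<lambda>t. y t p))"
proof -
  define Y where "Y = picard F c"
  have Y0: "Y 0 t p = c p" and
    YS: "Y (Suc k) t p = c p + integral {0..t} (\<lambda>s. F p s (Y k s p))" for k t p
    by (simp_all add: Y_def)
  have Yc: "continuous_on ({0..} \<times> UNIV) (\<lambda>(t, p). Y k t p)" for k
  proof (induction k)
    case 0
    then show ?case
      by (auto simp: Y0 case_prod_unfold intro!: continuous_on_compose2[OF c] continuous_intros)
  next
    case (Suc k)
    have "continuous_on ({0..} \<times> UNIV) (\<lambda>(t::real, p). c p)"
      by (auto simp: case_prod_unfold intro!: continuous_on_compose2[OF c] continuous_intros)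
    from continuous_on_add[OF this
        continuous_on_integral_to[OF continuous_on_nonautonomous_field[OF F Suc]]]
    show ?case by (simp add: YS case_prod_unfold)
  qed
  have FYc: "continuous_on ({0..} \<times> UNIV) (\<lambda>(t, p). F p t (Y k t p))" for k
    by (rule continuous_on_nonautonomous_field[OF F Yc])
  have int: "(\<lambda>s. F p s (Y k s p)) integrable_on {0..t}" for k t p
    by (rule integrable_continuous_real[OF continuous_on_time_slice[OF FYc]]) auto
  \<comment> \<open>\<open>C\<close> bounds the first Picard step on \<open>{0..T}\<close>.
    Integrating \<open>exp (2 * L * s)\<close> produces \<open>1 / (2 * L)\<close>, which cancels
    the Lipschitz constant and leaves the factor 1/2.\<close>
  have Ydiff: "norm (Y (Suc k) t p - Y k t p) \<le> C * exp (2 * L * t) / 2 ^ k"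
    if C: "\<And>t. t \<in> {0..T} \<Longrightarrow> norm (Y 1 t p - Y 0 t p) \<le> C" "C \<ge> 0" and t: "t \<in> {0..T}" for C T t p k
    using t
  proof (induction k arbitrary: t)
    case 0
    have "norm (Y 1 t p - Y 0 t p) \<le> C * 1" using C 0 by simp
    also have "\<dots> \<le> C * exp (2 * L * t)" using C 0 L by (intro mult_left_mono) auto
    finally show ?case by simp
  next
    case (Suc k)
    have "norm (Y (Suc (Suc k)) t p - Y (Suc k) t p) =
      norm (integral {0..t} (\<lambda>s. F p s (Y (Suc k) s p) - F p s (Y k s p)))"
      by (simp only: YS[of "Suc k" t p] YS[of k t p] add_diff_cancel_left) (simp add: int integral_diff)
    also have "\<dots> \<le> integral {0..t} (\<lambda>s. (L * C / 2 ^ k) * exp (2 * L * s))"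
    proof (rule integral_norm_bound_integral)
      fix s assume s: "s \<in> {0..t}"
      have "norm (F p s (Y (Suc k) s p) - F p s (Y k s p)) \<le> L * norm (Y (Suc k) s p - Y k s p)"
        using s by (intro lip) auto
      also have "\<dots> \<le> L * (C * exp (2 * L * s) / 2 ^ k)"
        using L Suc s by (intro mult_left_mono Suc.IH) auto
      finally show "norm (F p s (Y (Suc k) s p) - F p s (Y k s p)) \<le> (L * C / 2 ^ k) * exp (2 * L * s)"
        by (simp add: mult.assoc)
    qed (intro integrable_diff int integrable_continuous_real[OF continuous_on_mult] continuous_intros)+
    also have "\<dots> = (L * C / 2 ^ k) * integral {0..t} (\<lambda>s. exp (2 * L * s))" by simp
    also have "\<dots> \<le> (L * C / 2 ^ k) * (exp (2 * L * t) / (2 * L))"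
      using integral_exp_le[of "2 * L" t] L C Suc by (intro mult_left_mono) auto
    also have "\<dots> = C * exp (2 * L * t) / 2 ^ Suc k" using L by simp
    finally show ?case .
  qed
  define y where "y t p = lim (\<lambda>k. Y k t p)" for t p
  have unif: "uniform_limit ({0..T} \<times> cball q 1) (\<lambda>k (t, p). Y k t p) (\<lambda>(t, p). y t p) sequentially" for T q
  proof -
    let ?U = "{0..T} \<times> cball q 1"
    have "continuous_on ?U (\<lambda>z. (case z of (t, p) \<Rightarrow> Y 1 t p) - (case z of (t, p) \<Rightarrow> Y 0 t p))"
      by (intro continuous_on_diff continuous_on_subset[OF Yc]) auto
    \<comment> \<open>Compactness of the closed ball in the finite-dimensional parameter space
      supplies one \<open>C\<close> for all parameters in it.\<close>
    then have "bounded ((\<lambda>z. (case z of (t, p) \<Rightarrow> Y 1 t p) - (case z of (t, p) \<Rightarrow> Y 0 t p)) ` ?U)"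
      by (intro compact_imp_bounded compact_continuous_image compact_Times) auto
    then obtain C where C: "C > 0" "\<And>t p. t \<in> {0..T} \<Longrightarrow> p \<in> cball q 1 \<Longrightarrow> norm (Y 1 t p - Y 0 t p) \<le> C"
      unfolding bounded_pos by fastforce
    have "uniformly_convergent_on ?U (\<lambda>n z. \<Sum>i<n. Y (Suc i) (fst z) (snd z) - Y i (fst z) (snd z))"
    proof (rule Weierstrass_m_test')
      show "summable (\<lambda>k. (C * exp (2 * L * T)) * (1 / 2) ^ k)"
        by (intro summable_mult summable_geometric) simp
      fix k z assume z: "z \<in> ?U"
      have "norm (Y (Suc k) (fst z) (snd z) - Y k (fst z) (snd z)) \<le> C * exp (2 * L * fst z) / 2 ^ k"
        using z C by (intro Ydiff[of T]) auto
      also have "\<dots> \<le> C * exp (2 * L * T) / 2 ^ k"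
        using z C L by (intro divide_right_mono mult_left_mono) auto
      finally show "norm (Y (Suc k) (fst z) (snd z) - Y k (fst z) (snd z)) \<le> (C * exp (2 * L * T)) * (1 / 2) ^ k"
        by (simp add: power_divide)
    qed
    then have "uniformly_convergent_on ?U (\<lambda>n z. Y n (fst z) (snd z) - Y 0 (fst z) (snd z))"
      by (simp only: sum_lessThan_telescope[of "\<lambda>i. Y i (fst z) (snd z)" for z])
    then obtain l where "uniform_limit ?U (\<lambda>n z. Y n (fst z) (snd z) - Y 0 (fst z) (snd z)) l sequentially"
      by (auto simp: uniformly_convergent_on_def)
    then have "uniform_limit ?U (\<lambda>n z. Y n (fst z) (snd z)) (\<lambda>z. l z + Y 0 (fst z) (snd z)) sequentially"
      unfolding uniform_limit_iff by (simp add: dist_norm algebra_simps)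
    then have "uniformly_convergent_on ?U (\<lambda>n z. Y n (fst z) (snd z))"
      by (auto simp: uniformly_convergent_on_def)
    then show ?thesis
      by (simp add: uniformly_convergent_uniform_limit_iff y_def case_prod_unfold)
  qed
  have yc: "continuous_on ({0..} \<times> UNIV) (\<lambda>(t, p). y t p)"
    unfolding continuous_on_eq_continuous_within
  proof (intro ballI)
    fix z :: "real \<times> 'p" assume z: "z \<in> {0..} \<times> UNIV"
    let ?U = "{0..fst z + 1} \<times> cball (snd z) 1"
    have "continuous_on ?U (\<lambda>(t, p). y t p)"
      by (rule uniform_limit_theorem[OF always_eventually unif])
        (auto intro!: continuous_on_subset[OF Yc])
    moreover have "at z within {0..} \<times> UNIV = at z within ?U"
      by (rule at_within_nhd[of _ "{..<fst z + 1} \<times> ball (snd z) 1"])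
        (auto intro!: open_Times simp: mem_Times_iff)
    moreover have "z \<in> ?U" using z by (auto simp: mem_Times_iff)
    ultimately show "continuous (at z within {0..} \<times> UNIV) (\<lambda>(t, p). y t p)"
      unfolding continuous_on_eq_continuous_within by metis
  qed
  have Fyc: "continuous_on ({0..} \<times> UNIV) (\<lambda>(t, p). F p t (y t p))"
    by (rule continuous_on_nonautonomous_field[OF F yc])
  have inty: "(\<lambda>s. F p s (y s p)) integrable_on {0..t}" for t p
    by (rule integrable_continuous_real[OF continuous_on_time_slice[OF Fyc]]) auto
  have lim: "(\<lambda>k. Y k t p) \<longlonglongrightarrow> y t p" if "t \<ge> 0" for t p
    using tendsto_uniform_limitI[OF unif[of t p], of "(t, p)"] that by simp
  \<comment> \<open>The recursion passes to the limit: the Lipschitz bound transfers the uniform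
    convergence of the iterates to the integrands. Differentiating the resulting integral equation
    gives the differential equation.\<close>
  have fp: "y t p = c p + integral {0..t} (\<lambda>s. F p s (y s p))" if t: "t \<ge> 0" for t p
  proof (rule LIMSEQ_unique)
    show "(\<lambda>k. Y (Suc k) t p) \<longlonglongrightarrow> y t p" by (rule LIMSEQ_Suc[OF lim[OF t]])
    have "uniform_limit {0..t} (\<lambda>k s. F p s (Y k s p)) (\<lambda>s. F p s (y s p)) sequentially"
    proof (rule uniform_limitI)
      fix e :: real assume e: "e > 0"
      from uniform_limitD[OF unif[of t p], of "e / L"] e L
      have "\<forall>\<^sub>F k in sequentially. \<forall>s\<in>{0..t}. dist (Y k s p) (y s p) < e / L"
        by (auto elim!: eventually_mono)
      then show "\<forall>\<^sub>F k in sequentially. \<forall>s\<in>{0..t}. dist (F p s (Y k s p)) (F p s (y s p)) < e"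
      proof eventually_elim
        case (elim k)
        show ?case
        proof
          fix s assume s: "s \<in> {0..t}"
          have "dist (F p s (Y k s p)) (F p s (y s p)) \<le> L * dist (Y k s p) (y s p)"
            using lip s by (simp add: dist_norm)
          also have "\<dots> < e" using elim s L by (auto simp: field_simps)
          finally show "dist (F p s (Y k s p)) (F p s (y s p)) < e" .
        qed
      qed
    qed
    then obtain I J where IJ: "\<And>k. ((\<lambda>s. F p s (Y k s p)) has_integral I k) {0..t}"
      "((\<lambda>s. F p s (y s p)) has_integral J) {0..t}" "(I \<longlongrightarrow> J) sequentially"
      by (rule uniform_limit_integral) (auto intro!: continuous_on_time_slice[OF FYc])
    then show "(\<lambda>k. Y (Suc k) t p) \<longlonglongrightarrow> c p + integral {0..t} (\<lambda>s. F p s (y s p))"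
      by (simp add: YS integral_unique[OF IJ(1)] integral_unique[OF IJ(2)] tendsto_add)
  qed
  have "is_solution {0..} (F p) (\<lambda>t. y t p)" for p
  proof -
    have "((\<lambda>t. c p + integral {0..t} (\<lambda>s. F p s (y s p))) has_vector_derivative F p t (y t p)) (at t within {0..})"
      if "t \<ge> 0" for t
      using integral_has_vector_derivative_atLeast[OF continuous_on_time_slice[OF Fyc] that, of p]
      by (auto intro!: derivative_eq_intros)
    then show ?thesis unfolding is_solution_def
      using fp by (metis (mono_tags, lifting) atLeast_iff has_vector_derivative_transform)
  qed
  moreover have "y 0 p = c p" for p using fp[of 0 p] by simp
  ultimately show ?thesis using yc by blast
qed

text \<open>Uniqueness identifies \<open>z\<close> with the Picard solutions for the initial values
  \<open>z 0 p\<close>, so continuity in the parameter has to be checked at time \<open>0\<close>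
  only. The later differentiability proofs rest on this.\<close>

corollary lipschitz_solutions_jointly_continuous:
  fixes F :: "'p::euclidean_space \<Rightarrow> real \<Rightarrow> real ^ 'n \<Rightarrow> real ^ 'n"
  assumes F: "continuous_on ({0..} \<times> UNIV) (\<lambda>(t, p, x). F p t x)"
    and lip: "\<And>p t x y. t \<ge> 0 \<Longrightarrow> norm (F p t x - F p t y) \<le> L * norm (x - y)"
    and L: "L > 0" and c: "continuous_on UNIV (z 0)"
    and z: "\<And>p. is_solution {0..} (F p) (\<lambda>t. z t p)"
  shows "continuous_on ({0..} \<times> UNIV) (\<lambda>(t, p). z t p)"
proof -
  obtain y where y: "continuous_on ({0..} \<times> UNIV) (\<lambda>(t, p). y t p)"
    "\<And>p. y 0 p = z 0 p" "\<And>p. is_solution {0..} (F p) (\<lambda>t. y t p)"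
    using lipschitz_ode_exists[OF F lip L c] by blast
  have "y t p = z t p" if "t \<ge> 0" for t p
    by (rule lipschitz_solution_unique[OF lip y(3) z y(2) that])
  then show ?thesis
    by (intro continuous_on_eq[OF y(1)]) auto
qed

section \<open>Functions of class C^r in the space variable\<close>

text \<open>In contrast to \<^const>\<open>space_derivs_continuous\<close> the derivatives are total, which gives the
  chain rule, and the codomain is arbitrary, which admits scalar coefficients.\<close>

primrec C_space :: "nat \<Rightarrow> real set \<Rightarrow> (real \<Rightarrow> real ^ 'n \<Rightarrow> 'b::real_normed_vector) \<Rightarrow> bool" where
  "C_space 0 J F \<longleftrightarrow> continuous_on (J \<times> UNIV) (\<lambda>(t, u). F t u)"
| "C_space (Suc r) J F \<longleftrightarrow> continuous_on (J \<times> UNIV) (\<lambda>(t, u). F t u) \<and>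
     (\<exists>D. (\<forall>i. C_space r J (D i)) \<and>
       (\<forall>t\<in>J. \<forall>u. (F t has_derivative (\<lambda>h. \<Sum>i\<in>UNIV. h $ i *\<^sub>R D i t u)) (at u)))"

lemma C_space_continuous:
  "C_space r J F \<Longrightarrow> continuous_on (J \<times> UNIV) (\<lambda>(t, u). F t u)"
  by (cases r) auto

lemma C_space_SucE:
  assumes "C_space (Suc r) J F"
  obtains D where "\<And>i. C_space r J (D i)"
    "\<And>t u. t \<in> J \<Longrightarrow> (F t has_derivative (\<lambda>h. \<Sum>i\<in>UNIV. h $ i *\<^sub>R D i t u)) (at u)"
  using assms unfolding C_space.simps by blast

lemma C_space_SucI_derivative:
  assumes "C_space 0 J F" "\<And>i. C_space r J (D i)"
    and "\<And>t u. t \<in> J \<Longrightarrow> (F t has_derivative (\<lambda>h. \<Sum>i\<in>UNIV. h $ i *\<^sub>R D i t u)) (at u)"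
  shows "C_space (Suc r) J F"
  using assms unfolding C_space.simps by blast

lemma C_space_SucD: "C_space (Suc r) J F \<Longrightarrow> C_space r J F"
proof (induction r arbitrary: F)
  case (Suc r)
  from Suc.prems obtain D where "\<And>i. C_space (Suc r) J (D i)"
    "\<And>t u. t \<in> J \<Longrightarrow> (F t has_derivative (\<lambda>h. \<Sum>i\<in>UNIV. h $ i *\<^sub>R D i t u)) (at u)"
    by (rule C_space_SucE) blast
  with Suc.IH C_space_continuous[OF Suc.prems] show ?case
    by (intro C_space_SucI_derivative[of _ _ _ D]) auto
qed auto

lemma C_space_mono: "r \<le> s \<Longrightarrow> C_space s J F \<Longrightarrow> C_space r J F"
  by (induction s rule: dec_induct) (use C_space_SucD in blast)+

lemma C_space_cong:
  assumes "C_space r J F" "\<And>t u. t \<in> J \<Longrightarrow> F t u = G t u"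
  shows "C_space r J G"
proof -
  have *: "continuous_on (J \<times> UNIV) (\<lambda>(t, u). G t u)"
    by (rule continuous_on_eq[OF C_space_continuous[OF assms(1)]]) (use assms(2) in auto)
  have "F t = G t" if "t \<in> J" for t using assms(2)[OF that] by auto
  with * assms(1) show ?thesis by (cases r) auto
qed

lemma continuous_on_joint_compose:
  assumes g: "continuous_on (J \<times> UNIV) (\<lambda>(t, x). g t x)"
    and a: "continuous_on S a" "a ` S \<subseteq> J" and h: "continuous_on S h"
  shows "continuous_on S (\<lambda>z. g (a z) (h z))"
proof -
  have "continuous_on S (\<lambda>z. case (a z, h z) of (t, x) \<Rightarrow> g t x)"
    by (rule continuous_on_compose2[OF g]) (use a h in \<open>auto intro!: continuous_intros\<close>)
  then show ?thesis by simp
qed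

lemma C_space_compose_continuous:
  assumes "C_space r J F" "continuous_on S a" "a ` S \<subseteq> J" "continuous_on S h"
  shows "continuous_on S (\<lambda>z. F (a z) (h z))"
  by (rule continuous_on_joint_compose[OF C_space_continuous[OF assms(1)] assms(2-4)])

lemma C_space_zero: "C_space r J (\<lambda>t u. 0)"
  by (induction r) (auto simp: case_prod_unfold intro!: exI[of _ "\<lambda>_ _ _. 0"])

lemma C_space_time:
  assumes "continuous_on J a" shows "C_space r J (\<lambda>t u. a t)"
proof -
  have "continuous_on (J \<times> UNIV) (\<lambda>(t, u). a t)"
    unfolding case_prod_unfold
    by (rule continuous_on_compose2[OF assms]) (auto intro!: continuous_intros)
  then show ?thesis
    by (cases r) (auto intro!: exI[of _ "\<lambda>_ _ _. 0"] C_space_zero)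
qed

lemma C_space_id: "C_space r J (\<lambda>t u. u)"
proof (cases r)
  case (Suc k)
  have "((\<lambda>u. u) has_derivative (\<lambda>h. \<Sum>i\<in>UNIV. h $ i *\<^sub>R axis i 1)) (at u)" for u :: "real ^ 'n"
    by (rule has_derivative_eq_rhs[OF has_derivative_ident])
      (simp add: basis_expansion scalar_mult_eq_scaleR[symmetric])
  with Suc show ?thesis
    by (auto simp: case_prod_unfold intro!: continuous_intros exI[of _ "\<lambda>i _ _. axis i 1"] C_space_time)
qed (auto simp: case_prod_unfold intro!: continuous_intros)

lemma C_space_bounded_linear:
  assumes T: "bounded_linear T" and "C_space r J F"
  shows "C_space r J (\<lambda>t u. T (F t u))"
  using assms(2)
proof (induction r arbitrary: F)
  case 0
  then show ?case
    using bounded_linear.continuous_on[OF T, of _ "\<lambda>(t, u). F t u"] by (simp add: case_prod_unfold)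
next
  case (Suc r)
  from Suc.prems(1) obtain D where D: "\<And>i. C_space r J (D i)"
    "\<And>t u. t \<in> J \<Longrightarrow> (F t has_derivative (\<lambda>h. \<Sum>i\<in>UNIV. h $ i *\<^sub>R D i t u)) (at u)"
    by (rule C_space_SucE) blast
  interpret bounded_linear T by fact
  have "((\<lambda>u. T (F t u)) has_derivative (\<lambda>h. \<Sum>i\<in>UNIV. h $ i *\<^sub>R T (D i t u))) (at u)" if "t \<in> J" for t u
    by (rule has_derivative_eq_rhs[OF has_derivative[OF D(2)[OF that]]]) (simp add: sum scaleR)
  moreover have "continuous_on (J \<times> UNIV) (\<lambda>(t, u). T (F t u))"
    using continuous_on[OF C_space_continuous[OF Suc.prems]] by (simp add: case_prod_unfold)
  ultimately show ?case using Suc.IH[OF D(1)] by (auto intro!: exI[of _ "\<lambda>i t u. T (D i t u)"])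
qed

lemmas C_space_nth = C_space_bounded_linear[OF bounded_linear_vec_nth]

lemma C_space_add:
  assumes "C_space r J F" "C_space r J G"
  shows "C_space r J (\<lambda>t u. F t u + G t u)"
  using assms
proof (induction r arbitrary: F G)
  case 0
  then show ?case
    using continuous_on_add by (fastforce simp: case_prod_unfold)
next
  case (Suc r)
  from Suc.prems(1) obtain D where D: "\<And>i. C_space r J (D i)"
    "\<And>t u. t \<in> J \<Longrightarrow> (F t has_derivative (\<lambda>h. \<Sum>i\<in>UNIV. h $ i *\<^sub>R D i t u)) (at u)"
    by (rule C_space_SucE) blast
  from Suc.prems(2) obtain E where E: "\<And>i. C_space r J (E i)"
    "\<And>t u. t \<in> J \<Longrightarrow> (G t has_derivative (\<lambda>h. \<Sum>i\<in>UNIV. h $ i *\<^sub>R E i t u)) (at u)"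
    by (rule C_space_SucE) blast
  have "((\<lambda>u. F t u + G t u) has_derivative (\<lambda>h. \<Sum>i\<in>UNIV. h $ i *\<^sub>R (D i t u + E i t u))) (at u)"
    if "t \<in> J" for t u
    by (rule has_derivative_eq_rhs[OF has_derivative_add[OF D(2)[OF that] E(2)[OF that]]])
      (simp add: sum.distrib scaleR_add_right)
  moreover have "continuous_on (J \<times> UNIV) (\<lambda>(t, u). F t u + G t u)"
    using continuous_on_add[OF Suc.prems[THEN C_space_continuous]] by (simp add: case_prod_unfold)
  ultimately show ?case using Suc.IH[OF D(1) E(1)] by (auto intro!: exI[of _ "\<lambda>i t u. D i t u + E i t u"])
qed

lemma C_space_sum:
  assumes "\<And>i. i \<in> I \<Longrightarrow> C_space r J (F i)"
  shows "C_space r J (\<lambda>t u. \<Sum>i\<in>I. F i t u)"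
  using assms by (induction I rule: infinite_finite_induct) (auto intro: C_space_zero C_space_add)

lemma C_space_scaleR:
  assumes "C_space r J a" "C_space r J G"
  shows "C_space r J (\<lambda>t u. a t u *\<^sub>R G t u)"
  using assms
proof (induction r arbitrary: a G)
  case 0
  then show ?case
    using continuous_on_scaleR by (fastforce simp: case_prod_unfold)
next
  case (Suc r)
  from Suc.prems(1) obtain D where D: "\<And>i. C_space r J (D i)"
    "\<And>t u. t \<in> J \<Longrightarrow> (a t has_derivative (\<lambda>h. \<Sum>i\<in>UNIV. h $ i *\<^sub>R D i t u)) (at u)"
    by (rule C_space_SucE) blast
  from Suc.prems(2) obtain E where E: "\<And>i. C_space r J (E i)"
    "\<And>t u. t \<in> J \<Longrightarrow> (G t has_derivative (\<lambda>h. \<Sum>i\<in>UNIV. h $ i *\<^sub>R E i t u)) (at u)"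
    by (rule C_space_SucE) blast
  let ?D = "\<lambda>i t u. a t u *\<^sub>R E i t u + D i t u *\<^sub>R G t u"
  have "((\<lambda>u. a t u *\<^sub>R G t u) has_derivative (\<lambda>h. \<Sum>i\<in>UNIV. h $ i *\<^sub>R ?D i t u)) (at u)"
    if "t \<in> J" for t u
    by (rule has_derivative_eq_rhs[OF has_derivative_scaleR[OF D(2)[OF that] E(2)[OF that]]])
      (simp add: sum.distrib scaleR_add_right scaleR_sum_right scaleR_sum_left mult.commute)
  moreover have "continuous_on (J \<times> UNIV) (\<lambda>(t, u). a t u *\<^sub>R G t u)"
    using continuous_on_scaleR[OF Suc.prems[THEN C_space_continuous]] by (simp add: case_prod_unfold)
  moreover have "C_space r J (?D i)" for i
    using D(1) E(1) Suc.prems[THEN C_space_SucD] by (intro C_space_add Suc.IH) auto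
  ultimately show ?case by (auto intro!: exI[of _ ?D])
qed

text \<open>The partial derivatives of the composite are combinations of
  \<open>D j t (h t u)\<close> with components of the derivatives of \<open>h\<close>. The induction
  varies only \<open>g\<close>; the inner map stays \<open>h\<close>, regarded as of one class
  lower.\<close>

lemma C_space_compose:
  fixes h :: "real \<Rightarrow> real ^ 'n \<Rightarrow> real ^ 'm"
  assumes "C_space r J g" "C_space r J h"
  shows "C_space r J (\<lambda>t u. g t (h t u))"
  using assms
proof (induction r arbitrary: g)
  case 0
  have "continuous_on (J \<times> UNIV) (\<lambda>z. g (fst z) (case z of (t, u) \<Rightarrow> h t u))"
    by (rule C_space_compose_continuous[OF 0(1)])
      (use 0(2) in \<open>auto intro!: continuous_intros\<close>)
  then show ?case by (simp add: case_prod_unfold)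
next
  case (Suc r)
  from Suc.prems(1) obtain D where D: "\<And>i. C_space r J (D i)"
    "\<And>t u. t \<in> J \<Longrightarrow> (g t has_derivative (\<lambda>h. \<Sum>i\<in>UNIV. h $ i *\<^sub>R D i t u)) (at u)"
    by (rule C_space_SucE) blast
  from Suc.prems(2) obtain E where E: "\<And>i. C_space r J (E i)"
    "\<And>t u. t \<in> J \<Longrightarrow> (h t has_derivative (\<lambda>h. \<Sum>i\<in>UNIV. h $ i *\<^sub>R E i t u)) (at u)"
    by (rule C_space_SucE) blast
  let ?D = "\<lambda>i t u. \<Sum>j\<in>UNIV. (E i t u $ j) *\<^sub>R D j t (h t u)"
  have "((\<lambda>u. g t (h t u)) has_derivative (\<lambda>k. \<Sum>i\<in>UNIV. k $ i *\<^sub>R ?D i t u)) (at u)"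
    if "t \<in> J" for t u
  proof (rule has_derivative_eq_rhs[OF has_derivative_compose[OF E(2)[OF that] D(2)[OF that]]], rule ext)
    fix k :: "real ^ 'n"
    have "(\<Sum>j\<in>UNIV. (\<Sum>i\<in>UNIV. k $ i *\<^sub>R E i t u) $ j *\<^sub>R D j t (h t u)) =
      (\<Sum>j\<in>UNIV. \<Sum>i\<in>UNIV. (k $ i * E i t u $ j) *\<^sub>R D j t (h t u))"
      by (simp add: scaleR_sum_left)
    also have "\<dots> = (\<Sum>i\<in>UNIV. \<Sum>j\<in>UNIV. (k $ i * E i t u $ j) *\<^sub>R D j t (h t u))"
      by (rule sum.swap)
    finally show "(\<Sum>j\<in>UNIV. (\<Sum>i\<in>UNIV. k $ i *\<^sub>R E i t u) $ j *\<^sub>R D j t (h t u)) =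
      (\<Sum>i\<in>UNIV. k $ i *\<^sub>R ?D i t u)"
      by (simp add: scaleR_sum_right)
  qed
  moreover have "continuous_on (J \<times> UNIV) (\<lambda>z. g (fst z) (case z of (t, u) \<Rightarrow> h t u))"
    by (rule C_space_compose_continuous[OF Suc.prems(1)])
      (use C_space_continuous[OF Suc.prems(2)] in \<open>auto intro!: continuous_intros\<close>)
  moreover have "C_space r J (?D i)" for i
    using E(1) Suc.prems(2)[THEN C_space_SucD]
    by (intro C_space_sum C_space_scaleR C_space_nth Suc.IH D(1)) auto
  ultimately show ?case by (auto simp: case_prod_unfold intro!: exI[of _ ?D])
qed

section \<open>Total derivatives from continuous partial derivatives\<close>

lemma has_vector_derivative_line:
  fixes f :: "'a::real_vector \<Rightarrow> 'b::real_normed_vector"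
  assumes "((\<lambda>h. f (u + h *\<^sub>R e)) has_vector_derivative D) (at 0)" "u = v + s *\<^sub>R e"
  shows "((\<lambda>h. f (v + h *\<^sub>R e)) has_vector_derivative D) (at s)"
proof -
  have "((\<lambda>h. h - s) has_vector_derivative 1) (at s)"
    by (auto intro!: derivative_eq_intros)
  from vector_diff_chain_at[OF this, of "\<lambda>h. f (u + h *\<^sub>R e)" D] assms(1)
  have "((\<lambda>h. f (u + (h - s) *\<^sub>R e)) has_vector_derivative D) (at s)" by (simp add: o_def)
  moreover have "u + (h - s) *\<^sub>R e = v + h *\<^sub>R e" for h
    using assms(2) by (simp add: scaleR_diff_left)
  ultimately show ?thesis by simp
qed

text \<open>The increment is telescoped over the coordinates; the mean value inequality handles each of
  the one-dimensional increments.\<close>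

lemma has_derivative_if_continuous_partials:
  fixes f :: "real ^ 'n \<Rightarrow> 'b::real_normed_vector"
  assumes part: "\<And>i u. ((\<lambda>h. f (u + h *\<^sub>R axis i 1)) has_vector_derivative D i u) (at 0)"
    and cont: "\<And>i. continuous_on UNIV (D i)"
  shows "(f has_derivative (\<lambda>h. \<Sum>i\<in>UNIV. h $ i *\<^sub>R D i u)) (at u)"
  unfolding has_derivative_at_alt
proof (intro conjI allI impI)
  show "bounded_linear (\<lambda>h. \<Sum>i\<in>UNIV. h $ i *\<^sub>R D i u)"
    by (intro bounded_linear_sum bounded_linear_scaleR_const bounded_linear_vec_nth)
  fix e :: real assume e: "e > 0"
  \<comment> \<open>Each of the \<open>CARD('n)\<close> coordinate increments is allowed the error
    \<open>e' * norm h\<close>.\<close>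
  define e' where "e' = e / CARD('n)"
  have e': "e' > 0" using e by (simp add: e'_def)
  have "\<forall>i. \<exists>d>0. \<forall>v. norm (v - u) < d \<longrightarrow> norm (D i v - D i u) \<le> e'"
  proof
    fix i
    from cont[of i] e' have "\<exists>d>0. \<forall>v. dist v u < d \<longrightarrow> dist (D i v) (D i u) < e'"
      unfolding continuous_on_iff by auto
    then show "\<exists>d>0. \<forall>v. norm (v - u) < d \<longrightarrow> norm (D i v - D i u) \<le> e'"
      unfolding dist_norm using less_imp_le by blast
  qed
  then obtain d where d: "\<And>i. d i > 0" "\<And>i v. norm (v - u) < d i \<Longrightarrow> norm (D i v - D i u) \<le> e'"
    by metis
  have "norm (f y - f u - (\<Sum>i\<in>UNIV. (y - u) $ i *\<^sub>R D i u)) \<le> e * norm (y - u)"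
    if y: "norm (y - u) < Min (range d)" for y
  proof -
    define h where "h = y - u"
    have hd: "norm h < d i" for i using y by (simp add: h_def)
    \<comment> \<open>\<open>p S\<close> keeps the coordinates of \<open>h\<close> in
      \<open>S\<close>; as \<open>S\<close> grows, \<open>u + p S\<close> runs from \<open>u\<close>
      to \<open>y\<close> in axis-parallel steps.\<close>
    define p where "p S = (\<chi> i. if i \<in> S then h $ i else 0)" for S
    have "norm (f (u + p S) - f u - (\<Sum>i\<in>S. h $ i *\<^sub>R D i u)) \<le> (\<Sum>i\<in>S. \<bar>h $ i\<bar> * e')"
      if "finite S" for S
      using that
    proof (induction S rule: finite_induct)
      case empty
      have "p {} = 0" by (simp add: p_def vec_eq_iff)
      then show ?case by simp
    next
      case (insert i S)
      let ?v = "u + p S"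
      \<comment> \<open>Subtracting the linear term leaves a function whose derivative is
        \<open>D i\<close> at a nearby point minus \<open>D i u\<close>, which continuity makes
        small.\<close>
      let ?g = "\<lambda>s. f (?v + s *\<^sub>R axis i 1) - s *\<^sub>R D i u"
      have pi: "p (insert i S) = p S + h $ i *\<^sub>R axis i 1"
        using insert by (auto simp: p_def vec_eq_iff axis_def)
      have "norm (?g (h $ i) - ?g 0) \<le> e' * norm (h $ i - 0)"
      proof (rule differentiable_bound[where S = "closed_segment 0 (h $ i)"])
        fix s assume s: "s \<in> closed_segment 0 (h $ i)"
        let ?E = "D i (?v + s *\<^sub>R axis i 1) - D i u"
        have "(?g has_vector_derivative ?E) (at s)"
          by (rule derivative_eq_intros has_vector_derivative_line[OF part] refl | simp)+
        then show "(?g has_derivative (\<lambda>k. k *\<^sub>R ?E)) (at s within closed_segment 0 (h $ i))"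
          by (simp add: has_vector_derivative_def has_derivative_at_withinI)
        \<comment> \<open>The intermediate point is no farther from \<open>u\<close> than
          \<open>y\<close> is, because each coordinate of its offset is dominated by that of
          \<open>h\<close>.\<close>
        have "norm (p S + s *\<^sub>R axis i 1) \<le> norm h"
        proof (rule norm_le_componentwise_cart)
          fix j
          have "\<bar>s\<bar> \<le> \<bar>h $ i\<bar>" using s by (auto simp: closed_segment_eq_real_ivl split: if_splits)
          then show "norm ((p S + s *\<^sub>R axis i 1) $ j) \<le> norm (h $ j)"
            using insert by (auto simp: p_def axis_def)
        qed
        then have "norm ?E \<le> e'"
          using hd[of i] by (intro d) (simp add: algebra_simps)
        then show "onorm (\<lambda>k. k *\<^sub>R ?E) \<le> e'"
          by (intro onorm_le) (simp add: mult.commute[of e'] mult_left_mono)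
      qed auto
      then have "norm (f (u + p (insert i S)) - f (u + p S) - h $ i *\<^sub>R D i u) \<le> \<bar>h $ i\<bar> * e'"
        by (simp add: pi algebra_simps)
      with insert.IH have "norm ((f (u + p (insert i S)) - f (u + p S) - h $ i *\<^sub>R D i u) +
          (f (u + p S) - f u - (\<Sum>i\<in>S. h $ i *\<^sub>R D i u))) \<le> \<bar>h $ i\<bar> * e' + (\<Sum>i\<in>S. \<bar>h $ i\<bar> * e')"
        by (intro norm_triangle_mono)
      then show ?case using insert by (simp add: algebra_simps)
    qed
    from this[of UNIV] have "norm (f (u + p UNIV) - f u - (\<Sum>i\<in>UNIV. h $ i *\<^sub>R D i u)) \<le> (\<Sum>i\<in>UNIV. \<bar>h $ i\<bar> * e')"
      by simp
    also have "\<dots> \<le> (\<Sum>i\<in>(UNIV::'n set). norm h * e')"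
      using e' by (intro sum_mono mult_right_mono component_le_norm_cart) auto
    also have "\<dots> = e * norm h" by (simp add: e'_def)
    finally have "norm (f (u + p UNIV) - f u - (\<Sum>i\<in>UNIV. h $ i *\<^sub>R D i u)) \<le> e * norm h" .
    moreover have "p UNIV = h" by (simp add: p_def vec_eq_iff)
    ultimately show ?thesis by (simp add: h_def)
  qed
  moreover have "Min (range d) > 0" using d(1) by simp
  ultimately show "\<exists>d>0. \<forall>y. norm (y - u) < d \<longrightarrow>
      norm (f y - f u - (\<Sum>i\<in>UNIV. (y - u) $ i *\<^sub>R D i u)) \<le> e * norm (y - u)" by blast
qed

lemma has_vector_derivative_partial:
  assumes "(f has_derivative (\<lambda>h. \<Sum>i\<in>UNIV. h $ i *\<^sub>R D i)) (at u)"
  shows "((\<lambda>h. f (u + h *\<^sub>R axis i 1)) has_vector_derivative D i) (at 0)"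
proof -
  have line: "((\<lambda>h. u + h *\<^sub>R axis i 1) has_derivative (\<lambda>h. h *\<^sub>R axis i 1)) (at 0)"
    by (auto intro!: derivative_eq_intros)
  have "(\<Sum>j\<in>UNIV. (h *\<^sub>R axis i 1) $ j *\<^sub>R D j) = h *\<^sub>R D i" for h :: real
  proof -
    have "(\<Sum>j\<in>UNIV. (h *\<^sub>R axis i 1) $ j *\<^sub>R D j) = (\<Sum>j\<in>UNIV. if j = i then h *\<^sub>R D j else 0)"
      by (intro sum.cong) (auto simp: axis_def)
    then show ?thesis by simp
  qed
  then show ?thesis
    unfolding has_vector_derivative_def
    using has_derivative_compose[OF line, of f "\<lambda>h. \<Sum>i\<in>UNIV. h $ i *\<^sub>R D i"] assms by simp
qed

lemma C_space_SucI:
  assumes "C_space 0 J F" "\<And>i. C_space r J (D i)"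
    and "\<And>i t u. t \<in> J \<Longrightarrow> ((\<lambda>h. F t (u + h *\<^sub>R axis i 1)) has_vector_derivative D i t u) (at 0)"
  shows "C_space (Suc r) J F"
proof -
  have "(F t has_derivative (\<lambda>h. \<Sum>i\<in>UNIV. h $ i *\<^sub>R D i t u)) (at u)" if "t \<in> J" for t u
    by (rule has_derivative_if_continuous_partials[OF assms(3)[OF that]
        C_space_compose_continuous[OF assms(2)]]) (use that in auto)
  with assms(1,2) show ?thesis by auto
qed

text \<open>A total derivative restricts to the axes; conversely, joint continuity assembles the
  partial derivatives into a total derivative. This makes the chain rule available for a property
  that is phrased by partial derivatives.\<close>

lemma C_space_iff_space_derivs_continuous:
  "C_space r J F \<longleftrightarrow> space_derivs_continuous r J F"
proof (induction r arbitrary: F)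
  case (Suc r)
  show ?case
  proof
    assume "C_space (Suc r) J F"
    then obtain D where D: "\<And>i. C_space r J (D i)" "continuous_on (J \<times> UNIV) (\<lambda>(t, u). F t u)"
      "\<And>t u. t \<in> J \<Longrightarrow> (F t has_derivative (\<lambda>h. \<Sum>i\<in>UNIV. h $ i *\<^sub>R D i t u)) (at u)"
      by auto
    have "has_partial_derivative (F t) i (D i t)" if "t \<in> J" for t i
      unfolding has_partial_derivative_def using has_vector_derivative_partial[OF D(3)[OF that]] by blast
    then show "space_derivs_continuous (Suc r) J F"
      using D(1,2) Suc.IH by auto
  next
    assume *: "space_derivs_continuous (Suc r) J F"
    then have "\<forall>i. \<exists>D. (\<forall>t\<in>J. has_partial_derivative (F t) i (D t)) \<and> space_derivs_continuous r J D"
      by simp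
    then obtain D where D: "\<And>i t. t \<in> J \<Longrightarrow> has_partial_derivative (F t) i (D i t)"
      "\<And>i. space_derivs_continuous r J (D i)" by metis
    show "C_space (Suc r) J F"
      by (rule C_space_SucI[of _ _ _ D]) (use D * Suc.IH in \<open>auto simp: has_partial_derivative_def\<close>)
  qed
qed simp

lemma space_derivs_continuous_imp_C_map:
  "space_derivs_continuous r J F \<Longrightarrow> t \<in> J \<Longrightarrow> C_map r (F t)"
proof (induction r arbitrary: F)
  case 0
  then show ?case using continuous_on_joint_compose[of J F UNIV "\<lambda>_. t" "\<lambda>u. u"] by auto
next
  case (Suc r)
  then have "continuous_on UNIV (F t)"
    using continuous_on_joint_compose[of J F UNIV "\<lambda>_. t" "\<lambda>u. u"] by auto
  with Suc show ?case by simp metis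
qed

section \<open>Linear equations with smooth coefficients\<close>

lemma has_vector_derivative_iff_quotient:
  fixes f :: "real \<Rightarrow> 'b::real_normed_vector"
  shows "(f has_vector_derivative D) (at 0) \<longleftrightarrow> ((\<lambda>h. (f h - f 0) /\<^sub>R h) \<longlongrightarrow> D) (at 0)"
proof -
  have "(f has_vector_derivative D) (at 0) \<longleftrightarrow>
    ((\<lambda>h. norm (f h - f 0 - h *\<^sub>R D) / norm h) \<longlongrightarrow> 0) (at 0)"
    by (simp add: has_vector_derivative_def has_derivative_at bounded_linear_scaleR_left)
  also have "\<dots> \<longleftrightarrow> ((\<lambda>h. norm ((f h - f 0) /\<^sub>R h - D)) \<longlongrightarrow> 0) (at 0)"
  proof (rule filterlim_cong[OF refl refl])
    have "norm (f h - f 0 - h *\<^sub>R D) / norm h = norm ((f h - f 0) /\<^sub>R h - D)" if "h \<noteq> 0" for h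
    proof -
      have "(f h - f 0) /\<^sub>R h - D = (f h - f 0 - h *\<^sub>R D) /\<^sub>R h"
        using that by (simp add: scaleR_diff_right)
      then show ?thesis by (simp add: divide_inverse mult.commute)
    qed
    then show "\<forall>\<^sub>F h in at 0. norm (f h - f 0 - h *\<^sub>R D) / norm h = norm ((f h - f 0) /\<^sub>R h - D)"
      by (auto simp: eventually_at_filter)
  qed
  also have "\<dots> \<longleftrightarrow> ((\<lambda>h. (f h - f 0) /\<^sub>R h) \<longlongrightarrow> D) (at 0)"
    using tendsto_norm_zero_iff[of "\<lambda>h. (f h - f 0) /\<^sub>R h - D"] LIM_zero_iff[of "\<lambda>h. (f h - f 0) /\<^sub>R h" D]
    by blast
  finally show ?thesis .
qed

text \<open>The difference quotients in direction \<open>z\<close> obey the bound, hence so does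
  their limit. Linearised equations thus inherit the Lipschitz constant of the field.\<close>

lemma lipschitz_derivative_bound:
  fixes f :: "'a::real_normed_vector \<Rightarrow> 'b::real_normed_vector"
  assumes f: "(f has_derivative f') (at u)" and lip: "\<And>x y. norm (f x - f y) \<le> L * norm (x - y)"
  shows "norm (f' z) \<le> L * norm z"
proof -
  interpret f': bounded_linear f' using f by (rule has_derivative_bounded_linear)
  have line: "((\<lambda>h. u + h *\<^sub>R z) has_derivative (\<lambda>h. h *\<^sub>R z)) (at 0)"
    by (auto intro!: derivative_eq_intros)
  have "((\<lambda>h. f (u + h *\<^sub>R z)) has_vector_derivative f' z) (at 0)"
    unfolding has_vector_derivative_def
    using has_derivative_compose[OF line, of f f'] f by (simp add: f'.scaleR)
  then have "((\<lambda>h. (f (u + h *\<^sub>R z) - f u) /\<^sub>R h) \<longlongrightarrow> f' z) (at 0)"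
    by (simp add: has_vector_derivative_iff_quotient)
  then have "((\<lambda>h. norm ((f (u + h *\<^sub>R z) - f u) /\<^sub>R h)) \<longlongrightarrow> norm (f' z)) (at 0)"
    by (rule tendsto_norm)
  moreover have "norm ((f (u + h *\<^sub>R z) - f u) /\<^sub>R h) \<le> L * norm z" if "h \<noteq> 0" for h
  proof -
    have "norm (f (u + h *\<^sub>R z) - f u) \<le> \<bar>h\<bar> * (L * norm z)"
      using lip[of "u + h *\<^sub>R z" u] by (simp add: mult_ac)
    then have "norm (f (u + h *\<^sub>R z) - f u) / \<bar>h\<bar> \<le> L * norm z"
      using that by (simp add: divide_le_eq mult.commute)
    then show ?thesis by (simp add: divide_inverse mult.commute)
  qed
  ultimately show ?thesis
    by (intro tendsto_upperbound[of _ _ "at 0"]) (auto simp: eventually_at_filter)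
qed

text \<open>The mean of the \<open>i\<close>-th partial derivative over the segment from
  \<open>x\<close> to \<open>y\<close>, the coefficient in Hadamard's lemma. Unlike a difference
  quotient it stays continuous where \<open>x\<close> and \<open>y\<close> coincide.\<close>

definition hadamard ::
  "('n \<Rightarrow> real \<Rightarrow> real ^ 'n \<Rightarrow> 'b::banach) \<Rightarrow> 'n \<Rightarrow> real \<Rightarrow> real ^ 'n \<Rightarrow> real ^ 'n \<Rightarrow> 'b" where
  "hadamard D i t x y = integral {0..1} (\<lambda>s. D i t (x + s *\<^sub>R (y - x)))"

lemma hadamard_diagonal [simp]: "hadamard D i t x x = D i t x"
  by (simp add: hadamard_def)

lemma continuous_on_hadamard:
  assumes "C_space 0 J (D i)" "continuous_on S a" "a ` S \<subseteq> J" "continuous_on S p" "continuous_on S q"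
  shows "continuous_on S (\<lambda>z. hadamard D i (a z) (p z) (q z))"
proof -
  have "continuous_on (S \<times> cbox 0 (1::real)) (\<lambda>x. D i (a (fst x)) (p (fst x) + snd x *\<^sub>R (q (fst x) - p (fst x))))"
    using assms(3)
    by (intro C_space_compose_continuous[OF assms(1)] continuous_intros
        continuous_on_compose2[OF assms(2)] continuous_on_compose2[OF assms(4)]
        continuous_on_compose2[OF assms(5)]) auto
  then show ?thesis
    unfolding hadamard_def
    using integral_continuous_on_param[of S 0 "1::real" "\<lambda>z s. D i (a z) (p z + s *\<^sub>R (q z - p z))"]
    by (simp add: case_prod_unfold)
qed

context
  fixes J :: "real set" and F :: "real \<Rightarrow> real ^ 'n \<Rightarrow> 'b::banach" and D :: "'n \<Rightarrow> real \<Rightarrow> real ^ 'n \<Rightarrow> 'b"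
  assumes D: "\<And>i. C_space 0 J (D i)"
    and F: "\<And>t u. t \<in> J \<Longrightarrow> (F t has_derivative (\<lambda>h. \<Sum>i\<in>UNIV. h $ i *\<^sub>R D i t u)) (at u)"
begin

lemma hadamard_has_integral:
  assumes t: "t \<in> J"
  shows "((\<lambda>s. D i t (x + s *\<^sub>R (y - x))) has_integral hadamard D i t x y) {0..1}"
  unfolding hadamard_def
  by (intro integrable_integral integrable_continuous_real C_space_compose_continuous[OF D]
      continuous_intros) (use t in auto)

lemma hadamard_sum_has_integral:
  assumes "t \<in> J"
  shows "((\<lambda>s. \<Sum>i\<in>UNIV. z $ i *\<^sub>R D i t (x + s *\<^sub>R (y - x))) has_integral
    (\<Sum>i\<in>UNIV. z $ i *\<^sub>R hadamard D i t x y)) {0..1}"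
  by (intro has_integral_sum has_integral_cmul hadamard_has_integral assms) auto

text \<open>The fundamental theorem of calculus along the segment makes the increment a linear
  expression in \<open>y - x\<close> without a remainder term.\<close>

lemma hadamard_increment:
  assumes t: "t \<in> J"
  shows "F t y - F t x = (\<Sum>i\<in>UNIV. (y - x) $ i *\<^sub>R hadamard D i t x y)"
proof -
  have "((\<lambda>s. \<Sum>i\<in>UNIV. (y - x) $ i *\<^sub>R D i t (x + s *\<^sub>R (y - x))) has_integral
    F t (x + 1 *\<^sub>R (y - x)) - F t (x + 0 *\<^sub>R (y - x))) {0..1}"
  proof (rule fundamental_theorem_of_calculus)
    fix s :: real assume "s \<in> {0..1}"
    have line: "((\<lambda>s. x + s *\<^sub>R (y - x)) has_derivative (\<lambda>h. h *\<^sub>R (y - x))) (at s)"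
      by (auto intro!: derivative_eq_intros)
    have "((\<lambda>s. F t (x + s *\<^sub>R (y - x))) has_vector_derivative
      (\<Sum>i\<in>UNIV. (y - x) $ i *\<^sub>R D i t (x + s *\<^sub>R (y - x)))) (at s)"
      unfolding has_vector_derivative_def
      by (rule has_derivative_eq_rhs[OF has_derivative_compose[OF line F[OF t]]])
        (simp add: scaleR_sum_right)
    then show "((\<lambda>s. F t (x + s *\<^sub>R (y - x))) has_vector_derivative
      (\<Sum>i\<in>UNIV. (y - x) $ i *\<^sub>R D i t (x + s *\<^sub>R (y - x)))) (at s within {0..1})"
      by (rule has_vector_derivative_at_within)
  qed simp
  from has_integral_unique[OF this hadamard_sum_has_integral[OF t]] show ?thesis by simp
qed

lemma hadamard_increment_axis:
  assumes t: "t \<in> J"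
  shows "F t (x + h *\<^sub>R axis i 1) - F t x = h *\<^sub>R hadamard D i t x (x + h *\<^sub>R axis i 1)"
proof -
  have "(\<Sum>j\<in>UNIV. (x + h *\<^sub>R axis i 1 - x) $ j *\<^sub>R hadamard D j t x (x + h *\<^sub>R axis i 1)) =
    (\<Sum>j\<in>UNIV. if j = i then h *\<^sub>R hadamard D j t x (x + h *\<^sub>R axis i 1) else 0)"
    by (intro sum.cong) (auto simp: axis_def)
  then show ?thesis by (simp add: hadamard_increment[OF t])
qed

lemma derivative_sum_bound:
  assumes "t \<in> J" "\<And>x y. norm (F t x - F t y) \<le> L * norm (x - y)"
  shows "norm (\<Sum>i\<in>UNIV. z $ i *\<^sub>R D i t u) \<le> L * norm z"
  using lipschitz_derivative_bound[OF F[OF assms(1)] assms(2)] .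

text \<open>Averaging preserves the bound on the derivative, so a linear equation with the averaged
  coefficients is governed by the same \<open>L\<close>.\<close>

lemma hadamard_sum_bound:
  assumes t: "t \<in> J" and lip: "\<And>x y. norm (F t x - F t y) \<le> L * norm (x - y)"
  shows "norm (\<Sum>i\<in>UNIV. z $ i *\<^sub>R hadamard D i t x y) \<le> L * norm z"
proof -
  have "norm (\<Sum>i\<in>UNIV. z $ i *\<^sub>R hadamard D i t x y) =
      norm (integral {0..1} (\<lambda>s. \<Sum>i\<in>UNIV. z $ i *\<^sub>R D i t (x + s *\<^sub>R (y - x))))"
    by (simp add: integral_unique[OF hadamard_sum_has_integral[OF t]])
  also have "\<dots> \<le> integral {0..1::real} (\<lambda>s. L * norm z)"
    by (rule integral_norm_bound_integral)
      (auto intro!: derivative_sum_bound t lip has_integral_integrable[OF hadamard_sum_has_integral[OF t]])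
  finally show ?thesis by simp
qed

end

section \<open>Linear equations with a parameter\<close>

lemma linear_field_lipschitz:
  fixes b :: "'n \<Rightarrow> real ^ 'n"
  assumes "\<And>z. norm (\<Sum>j\<in>UNIV. z $ j *\<^sub>R b j) \<le> L * norm z"
  shows "norm ((\<Sum>j\<in>UNIV. x $ j *\<^sub>R b j) + g - ((\<Sum>j\<in>UNIV. y $ j *\<^sub>R b j) + g)) \<le> L * norm (x - y)"
  using assms[of "x - y"] by (simp add: scaleR_diff_left sum_subtractf)

lemma continuous_on_linear_field:
  fixes b :: "'n \<Rightarrow> real \<Rightarrow> 'p::topological_space \<Rightarrow> real ^ 'n"
  assumes "\<And>j. continuous_on ({0..} \<times> UNIV) (\<lambda>(t, p). b j t p)"
    and "continuous_on ({0..} \<times> UNIV) (\<lambda>(t, p). g t p)"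
  shows "continuous_on ({0..} \<times> UNIV) (\<lambda>(t, p, x). (\<Sum>j\<in>UNIV. x $ j *\<^sub>R b j t p) + g t p)"
proof -
  note continuous_on_joint_compose[OF assms(1), continuous_intros]
    continuous_on_joint_compose[OF assms(2), continuous_intros]
  show ?thesis
    unfolding case_prod_unfold by (intro continuous_intros) auto
qed

text \<open>The vectors \<open>b j\<close> are the columns of the coefficient matrix, and
  \<open>L\<close> bounds its operator norm. Columns match the form in which \<open>C_space\<close>
  presents a derivative.\<close>

lemma linear_ode_exists:
  fixes b :: "'n \<Rightarrow> real \<Rightarrow> 'p::euclidean_space \<Rightarrow> real ^ 'n"
  assumes b: "\<And>j. continuous_on ({0..} \<times> UNIV) (\<lambda>(t, p). b j t p)"
    and g: "continuous_on ({0..} \<times> UNIV) (\<lambda>(t, p). g t p)"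
    and L: "L > 0" "\<And>t p z. t \<ge> 0 \<Longrightarrow> norm (\<Sum>j\<in>UNIV. z $ j *\<^sub>R b j t p) \<le> L * norm z"
    and c: "continuous_on UNIV c"
  obtains y where "\<And>p. y 0 p = c p"
    "\<And>p. is_solution {0..} (\<lambda>t x. (\<Sum>j\<in>UNIV. x $ j *\<^sub>R b j t p) + g t p) (\<lambda>t. y t p)"
proof -
  have "\<exists>y. continuous_on ({0..} \<times> UNIV) (\<lambda>(t, p). y t p) \<and> (\<forall>p. y 0 p = c p \<and>
    is_solution {0..} (\<lambda>t x. (\<Sum>j\<in>UNIV. x $ j *\<^sub>R b j t p) + g t p) (\<lambda>t. y t p))"
    by (rule lipschitz_ode_exists[OF continuous_on_linear_field[OF b g] linear_field_lipschitz L(1) c])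
      (rule L(2))
  then show ?thesis using that by blast
qed

lemma linear_ode_jointly_continuous:
  fixes b :: "'n \<Rightarrow> real \<Rightarrow> 'p::euclidean_space \<Rightarrow> real ^ 'n"
  assumes b: "\<And>j. continuous_on ({0..} \<times> UNIV) (\<lambda>(t, p). b j t p)"
    and g: "continuous_on ({0..} \<times> UNIV) (\<lambda>(t, p). g t p)"
    and L: "L > 0" "\<And>t p z. t \<ge> 0 \<Longrightarrow> norm (\<Sum>j\<in>UNIV. z $ j *\<^sub>R b j t p) \<le> L * norm z"
    and c: "continuous_on UNIV (y 0)"
    and y: "\<And>p. is_solution {0..} (\<lambda>t x. (\<Sum>j\<in>UNIV. x $ j *\<^sub>R b j t p) + g t p) (\<lambda>t. y t p)"
  shows "continuous_on ({0..} \<times> UNIV) (\<lambda>(t, p). y t p)"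
  by (rule lipschitz_solutions_jointly_continuous[OF continuous_on_linear_field[OF b g]
        linear_field_lipschitz L(1) c y]) (use L(2) in auto)

text \<open>Initial values enter the smoothness class as families constant in time; this turns a
  time slice of a smooth family into such data.\<close>

lemma C_space_freeze:
  assumes "C_space r J F" "s \<in> J" shows "C_space r J (\<lambda>t. F s)"
  using assms
proof (induction r arbitrary: F)
  case 0
  have "continuous_on (J \<times> UNIV) (\<lambda>z. F s (snd z))"
    by (rule C_space_compose_continuous[OF 0(1)]) (use 0 in \<open>auto intro!: continuous_intros\<close>)
  then show ?case by (simp add: case_prod_unfold)
next
  case (Suc r)
  from Suc.prems(1) obtain D where D: "\<And>i. C_space r J (D i)"
    "\<And>t u. t \<in> J \<Longrightarrow> (F t has_derivative (\<lambda>h. \<Sum>i\<in>UNIV. h $ i *\<^sub>R D i t u)) (at u)"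
    by (rule C_space_SucE) blast
  have "continuous_on (J \<times> UNIV) (\<lambda>z. F s (snd z))"
    by (rule C_space_compose_continuous[OF Suc.prems(1)]) (use Suc.prems in \<open>auto intro!: continuous_intros\<close>)
  then show ?case
    using D Suc by (intro C_space_SucI_derivative[of _ _ _ "\<lambda>i t. D i s"]) (auto simp: case_prod_unfold)
qed

lemma is_solution_difference_quotient:
  assumes "is_solution J F x" "is_solution J G y"
    and "\<And>t. t \<in> J \<Longrightarrow> E t ((x t - y t) /\<^sub>R h) = (F t (x t) - G t (y t)) /\<^sub>R h"
  shows "is_solution J E (\<lambda>t. (x t - y t) /\<^sub>R h)"
  unfolding is_solution_def
proof
  fix t assume t: "t \<in> J"
  have "((\<lambda>t. (x t - y t) /\<^sub>R h) has_vector_derivative (F t (x t) - G t (y t)) /\<^sub>R h) (at t within J)"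
    using assms(1,2) t unfolding is_solution_def
    by (intro bounded_linear.has_vector_derivative[OF bounded_linear_scaleR_right] has_vector_derivative_diff) auto
  then show "((\<lambda>t. (x t - y t) /\<^sub>R h) has_vector_derivative E t ((x t - y t) /\<^sub>R h)) (at t within J)"
    using assms(3)[OF t] by simp
qed

lemma has_vector_derivative_from_quotient_family:
  assumes q: "continuous_on ({0..} \<times> UNIV) (\<lambda>(t, h). if h = 0 then w t else (z t h - z t 0) /\<^sub>R h)"
    and t: "t \<ge> 0"
  shows "(z t has_vector_derivative w t) (at (0::real))"
proof -
  let ?q = "\<lambda>t h. if h = 0 then w t else (z t h - z t 0) /\<^sub>R h"
  have "continuous_on UNIV (?q t)"
    using continuous_on_joint_compose[of "{0..}" ?q UNIV "\<lambda>_. t" "\<lambda>h. h"] q t by auto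
  then have "(?q t \<longlongrightarrow> ?q t 0) (at 0)" unfolding continuous_on_def by blast
  then have "(?q t \<longlongrightarrow> w t) (at 0)" by simp
  then have "((\<lambda>h. (z t h - z t 0) /\<^sub>R h) \<longlongrightarrow> w t) (at 0)"
    by (rule Lim_transform_eventually) (auto simp: eventually_at_filter)
  then show ?thesis by (simp add: has_vector_derivative_iff_quotient)
qed

text \<open>The difference quotients in a coordinate direction, completed at \<open>h = 0\<close> by the solution of the
  formally differentiated equation, solve a linear equation that depends continuously on the
  parameter \<open>h\<close>.\<close>

lemma C_space_linear_ode:
  fixes b :: "'n \<Rightarrow> real \<Rightarrow> real ^ 'm \<Rightarrow> real ^ 'n"
  assumes L: "L > 0" "\<And>t u z. t \<ge> 0 \<Longrightarrow> norm (\<Sum>j\<in>UNIV. z $ j *\<^sub>R b j t u) \<le> L * norm z"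
    and b: "\<And>j. C_space r {0..} (b j)" and g: "C_space r {0..} g" and c: "C_space r {0..} (\<lambda>t. z 0)"
    and z: "\<And>u. is_solution {0..} (\<lambda>t x. (\<Sum>j\<in>UNIV. x $ j *\<^sub>R b j t u) + g t u) (\<lambda>t. z t u)"
  shows "C_space r {0..} z"
  using b g c z
proof (induction r arbitrary: g z)
  case 0
  have "continuous_on UNIV (z 0)"
    using C_space_compose_continuous[OF 0(3), of UNIV "\<lambda>_. 0" "\<lambda>u. u"] by simp
  from linear_ode_jointly_continuous[OF 0(1)[THEN C_space_continuous] 0(2)[THEN C_space_continuous] L this 0(4)]
  show ?case by simp
next
  case (Suc r)
  \<comment> \<open>Data of class \<open>Suc r\<close> are also of class \<open>r\<close>, so the
    induction hypothesis applies to \<open>z\<close> itself. This is needed because \<open>z\<close>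
    occurs in the inhomogeneity \<open>gi\<close>.\<close>
  have zr: "C_space r {0..} z"
    by (rule Suc.IH[OF Suc.prems(1-3)[THEN C_space_SucD] Suc.prems(4)])
  let ?isD = "\<lambda>j D. (\<forall>i. C_space r {0..} (D i)) \<and>
    (\<forall>t\<in>{0..}. \<forall>u. (b j t has_derivative (\<lambda>h. \<Sum>i\<in>UNIV. h $ i *\<^sub>R D i t u)) (at u))"
  have "\<exists>D. ?isD j D" for j
    using Suc.prems(1)[of j] unfolding C_space.simps by (rule conjunct2)
  then have "\<forall>j. \<exists>D. ?isD j D" by (rule allI)
  from choice[OF this] obtain Db where "\<forall>j. ?isD j (Db j)" ..
  then have Db: "\<And>j i. C_space r {0..} (Db j i)"
    "\<And>j t u. t \<in> {0..} \<Longrightarrow> (b j t has_derivative (\<lambda>h. \<Sum>i\<in>UNIV. h $ i *\<^sub>R Db j i t u)) (at u)"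
    by blast+
  from Suc.prems(2) obtain Dg where Dg: "\<And>i. C_space r {0..} (Dg i)"
    "\<And>t u. t \<in> {0..} \<Longrightarrow> (g t has_derivative (\<lambda>h. \<Sum>i\<in>UNIV. h $ i *\<^sub>R Dg i t u)) (at u)"
    by (rule C_space_SucE) blast
  from Suc.prems(3) obtain Dc where Dc: "\<And>i. C_space r {0..} (Dc i)"
    "\<And>t u. t \<in> {0..} \<Longrightarrow> (z 0 has_derivative (\<lambda>h. \<Sum>i\<in>UNIV. h $ i *\<^sub>R Dc i t u)) (at u)"
    by (rule C_space_SucE) blast
  note cont = C_space_mono[OF le0]
  have b0: "continuous_on ({0..} \<times> UNIV) (\<lambda>(t, u). b j t u)" for j
    by (rule C_space_continuous[OF Suc.prems(1)])
  \<comment> \<open>Formal differentiation in direction \<open>i\<close> leaves the linear part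
    unchanged; the derivatives of \<open>b\<close>, applied to \<open>z\<close>, and of
    \<open>g\<close> form the new inhomogeneity.\<close>
  define gi where "gi i t u = (\<Sum>j\<in>UNIV. z t u $ j *\<^sub>R Db j i t u) + Dg i t u" for i t u
  have gi: "C_space r {0..} (gi i)" for i
    unfolding gi_def by (intro C_space_add C_space_sum C_space_scaleR C_space_nth zr Db Dg)
  have "\<exists>w. (\<forall>u. w 0 u = Dc i 0 u) \<and>
     (\<forall>u. is_solution {0..} (\<lambda>t x. (\<Sum>j\<in>UNIV. x $ j *\<^sub>R b j t u) + gi i t u) (\<lambda>t. w t u))" for i
  proof -
    have "continuous_on UNIV (Dc i 0)"
      by (rule C_space_compose_continuous[OF Dc(1)]) (auto intro!: continuous_intros)
    from linear_ode_exists[OF b0 C_space_continuous[OF gi] L this]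
    obtain w where "\<And>u. w 0 u = Dc i 0 u"
      "\<And>u. is_solution {0..} (\<lambda>t x. (\<Sum>j\<in>UNIV. x $ j *\<^sub>R b j t u) + gi i t u) (\<lambda>t. w t u)"
      by blast
    then show ?thesis by blast
  qed
  then have "\<forall>i. \<exists>w. (\<forall>u. w 0 u = Dc i 0 u) \<and>
     (\<forall>u. is_solution {0..} (\<lambda>t x. (\<Sum>j\<in>UNIV. x $ j *\<^sub>R b j t u) + gi i t u) (\<lambda>t. w t u))"
    by (rule allI)
  from choice[OF this] obtain w where w: "\<And>i u. w i 0 u = Dc i 0 u"
    "\<And>i u. is_solution {0..} (\<lambda>t x. (\<Sum>j\<in>UNIV. x $ j *\<^sub>R b j t u) + gi i t u) (\<lambda>t. w i t u)"
    by blast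
  \<comment> \<open>The induction hypothesis is used a second time, now for the candidates
    \<open>w i\<close> for the partial derivatives.\<close>
  have wr: "C_space r {0..} (w i)" for i
  proof (rule Suc.IH[OF Suc.prems(1)[THEN C_space_SucD] gi _ w(2)])
    have "w i 0 = Dc i 0" by (rule ext) (rule w(1))
    then show "C_space r {0..} (\<lambda>t. w i 0)" using C_space_freeze[OF Dc(1), of 0] by simp
  qed
  show ?case
  proof (rule C_space_SucI[OF cont[OF zr] wr])
    fix i :: 'm and t :: real and u :: "real ^ 'm" assume t: "t \<in> {0..}"
    let ?v = "\<lambda>h. u + h *\<^sub>R axis i 1"
    let ?bq = "\<lambda>j t h. hadamard (Db j) i t u (?v h)"
    \<comment> \<open>At \<open>h = 0\<close> the Hadamard terms reduce to partial derivatives, and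
      \<open>?gq t 0\<close> is \<open>gi i t u\<close>.\<close>
    let ?gq = "\<lambda>t h. (\<Sum>j\<in>UNIV. z t u $ j *\<^sub>R ?bq j t h) + hadamard Dg i t u (?v h)"
    let ?q = "\<lambda>t h. if h = 0 then w i t u else (z t (?v h) - z t (?v 0)) /\<^sub>R h"
    have "continuous_on ({0..} \<times> UNIV) (\<lambda>(t, h). ?q t h)"
    proof (rule linear_ode_jointly_continuous[OF _ _ L(1), where b = "\<lambda>j t h. b j t (?v h)" and g = ?gq])
      show "continuous_on ({0..} \<times> UNIV) (\<lambda>(t, h). b j t (?v h))" for j
        unfolding case_prod_unfold
        by (rule continuous_on_joint_compose[OF b0]) (auto intro!: continuous_intros)
      show "continuous_on ({0..} \<times> UNIV) (\<lambda>(t, h). ?gq t h)"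
        unfolding case_prod_unfold
        by (intro continuous_intros continuous_on_hadamard[of "{0..}"] cont[OF Db(1)] cont[OF Dg(1)]
            C_space_compose_continuous[OF zr]) auto
      have q0: "?q 0 = (\<lambda>h. hadamard Dc i 0 u (?v h))"
      proof
        fix h
        have "z 0 (?v h) - z 0 u = h *\<^sub>R hadamard Dc i 0 u (?v h)"
          using hadamard_increment_axis[OF cont[OF Dc(1)] Dc(2), where t = 0] by simp
        then show "?q 0 h = hadamard Dc i 0 u (?v h)" by (simp add: w(1))
      qed
      show "continuous_on UNIV (?q 0)"
        unfolding q0
        by (intro continuous_on_hadamard[of "{0..}"] cont[OF Dc(1)] continuous_intros) auto
      fix h
      show "is_solution {0..} (\<lambda>t x. (\<Sum>j\<in>UNIV. x $ j *\<^sub>R b j t (?v h)) + ?gq t h) (\<lambda>t. ?q t h)"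
      proof (cases "h = 0")
        case True
        then show ?thesis using w(2)[of u i] by (simp add: gi_def)
      next
        case False
        have "is_solution {0..} (\<lambda>t x. (\<Sum>j\<in>UNIV. x $ j *\<^sub>R b j t (?v h)) + ?gq t h)
          (\<lambda>t. (z t (?v h) - z t (?v 0)) /\<^sub>R h)"
        proof (rule is_solution_difference_quotient[OF Suc.prems(4) Suc.prems(4)])
          fix t :: real assume t: "t \<in> {0..}"
          let ?x = "z t (?v h)" and ?y = "z t u"
          have b': "b j t (?v h) - b j t u = h *\<^sub>R ?bq j t h" for j
            by (rule hadamard_increment_axis[OF cont[OF Db(1)] Db(2) t])
          have g': "g t (?v h) - g t u = h *\<^sub>R hadamard Dg i t u (?v h)"
            by (rule hadamard_increment_axis[OF cont[OF Dg(1)] Dg(2) t])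
          \<comment> \<open>The difference of products is split so that the coefficients at the
            displaced point \<open>?v h\<close>, which satisfy the bound \<open>L\<close>, act on
            \<open>?x - ?y\<close>. The remaining terms carry a factor \<open>h\<close>.\<close>
          have "((\<Sum>j\<in>UNIV. ?x $ j *\<^sub>R b j t (?v h)) + g t (?v h)) - ((\<Sum>j\<in>UNIV. ?y $ j *\<^sub>R b j t u) + g t u)
            = (\<Sum>j\<in>UNIV. (?x - ?y) $ j *\<^sub>R b j t (?v h)) +
              (\<Sum>j\<in>UNIV. ?y $ j *\<^sub>R (b j t (?v h) - b j t u)) + (g t (?v h) - g t u)"
            by (simp add: algebra_simps sum.distrib sum_subtractf)
          also have "\<dots> = (\<Sum>j\<in>UNIV. (?x - ?y) $ j *\<^sub>R b j t (?v h)) + h *\<^sub>R ?gq t h"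
            by (simp add: b' g' scaleR_sum_right scaleR_add_right mult.commute)
          finally show "(\<Sum>j\<in>UNIV. ((z t (?v h) - z t (?v 0)) /\<^sub>R h) $ j *\<^sub>R b j t (?v h)) + ?gq t h =
            (((\<Sum>j\<in>UNIV. z t (?v h) $ j *\<^sub>R b j t (?v h)) + g t (?v h)) -
             ((\<Sum>j\<in>UNIV. z t (?v 0) $ j *\<^sub>R b j t (?v 0)) + g t (?v 0))) /\<^sub>R h"
            using False by (simp add: scaleR_add_right scaleR_sum_right mult.assoc[symmetric])
        qed
        then show ?thesis using False by simp
      qed
    qed (use L in auto)
    from has_vector_derivative_from_quotient_family[of "\<lambda>t. w i t u" "\<lambda>t h. z t (?v h)" t] this t
    show "((\<lambda>h. z t (?v h)) has_vector_derivative w i t u) (at 0)" by simp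
  qed
qed

section \<open>Smoothness of the flow and of its inverse\<close>

context
  fixes F :: "real \<Rightarrow> real ^ 'n \<Rightarrow> real ^ 'n" and Y :: "real \<Rightarrow> real ^ 'n \<Rightarrow> real ^ 'n" and L :: real
  assumes F_cont: "C_space 0 {0..} F"
    and lip: "\<And>t x y. t \<ge> 0 \<Longrightarrow> norm (F t x - F t y) \<le> L * norm (x - y)" and L: "L > 0"
    and Y_init: "\<And>u. Y 0 u = u" and Y_sol: "\<And>u. is_solution {0..} F (\<lambda>t. Y t u)"
begin

text \<open>The initial value plays the role of the parameter; the field itself does not depend on
  it.\<close>

lemma flow_continuous: "C_space 0 {0..} Y"
proof -
  have "continuous_on ({0..} \<times> UNIV) (\<lambda>(t, p, x). F t x)"
    unfolding case_prod_unfold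
    by (rule C_space_compose_continuous[OF F_cont]) (auto intro!: continuous_intros)
  then have "continuous_on ({0..} \<times> UNIV) (\<lambda>(t, u). Y t u)"
    by (rule lipschitz_solutions_jointly_continuous[OF _ lip L])
      (auto simp: Y_init Y_sol intro: continuous_on_id)
  then show ?thesis by simp
qed

text \<open>By Hadamard's lemma the difference quotient of the flow solves a linear equation whose
  coefficients are jointly continuous in time and step size.\<close>

lemma flow_partial_derivative:
  assumes D: "\<And>i. C_space 0 {0..} (D i)"
    and FD: "\<And>t u. t \<in> {0..} \<Longrightarrow> (F t has_derivative (\<lambda>h. \<Sum>i\<in>UNIV. h $ i *\<^sub>R D i t u)) (at u)"
    and Z: "Z 0 = axis i 1" "is_solution {0..} (\<lambda>t x. \<Sum>j\<in>UNIV. x $ j *\<^sub>R D j t (Y t u)) Z"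
    and t: "t \<ge> 0"
  shows "((\<lambda>h. Y t (u + h *\<^sub>R axis i 1)) has_vector_derivative Z t) (at 0)"
proof -
  let ?v = "\<lambda>h. u + h *\<^sub>R axis i 1"
  \<comment> \<open>\<open>?b\<close> linearises \<open>F\<close> exactly between two trajectories;
    at \<open>h = 0\<close> it becomes the coefficient of the variational equation along
    \<open>Y t u\<close>.\<close>
  let ?b = "\<lambda>j t h. hadamard D j t (Y t u) (Y t (?v h))"
  let ?q = "\<lambda>t h. if h = 0 then Z t else (Y t (?v h) - Y t (?v 0)) /\<^sub>R h"
  have "continuous_on ({0..} \<times> UNIV) (\<lambda>(t, h). ?q t h)"
  proof (rule linear_ode_jointly_continuous[OF _ _ L, where b = ?b and g = "\<lambda>_ _. 0"])
    show "continuous_on ({0..} \<times> UNIV) (\<lambda>(t, h). ?b j t h)" for j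
      unfolding case_prod_unfold
      by (intro continuous_on_hadamard[of "{0..}"] D C_space_compose_continuous[OF flow_continuous]
          continuous_intros) auto
    show "norm (\<Sum>j\<in>UNIV. z $ j *\<^sub>R ?b j t h) \<le> L * norm z" if "t \<ge> 0" for t h z
      by (rule hadamard_sum_bound[OF D FD]) (use that lip in auto)
    have q0: "?q 0 = (\<lambda>h. axis i 1)" by (auto simp: fun_eq_iff Z(1) Y_init)
    show "continuous_on UNIV (?q 0)" unfolding q0 by (rule continuous_on_const)
    fix h
    show "is_solution {0..} (\<lambda>t x. (\<Sum>j\<in>UNIV. x $ j *\<^sub>R ?b j t h) + 0) (\<lambda>t. ?q t h)"
    proof (cases "h = 0")
      case True
      then show ?thesis using Z(2) by simp
    next
      case False
      have "is_solution {0..} (\<lambda>t x. (\<Sum>j\<in>UNIV. x $ j *\<^sub>R ?b j t h) + 0) (\<lambda>t. (Y t (?v h) - Y t (?v 0)) /\<^sub>R h)"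
      proof (rule is_solution_difference_quotient[OF Y_sol Y_sol])
        fix t :: real assume "t \<in> {0..}"
        from hadamard_increment[OF D FD this, of "Y t (?v h)" "Y t u"]
        show "(\<Sum>j\<in>UNIV. ((Y t (?v h) - Y t (?v 0)) /\<^sub>R h) $ j *\<^sub>R ?b j t h) + 0 =
          (F t (Y t (?v h)) - F t (Y t (?v 0))) /\<^sub>R h"
          by (simp add: scaleR_sum_right)
      qed
      then show ?thesis using False by simp
    qed
  qed simp
  from has_vector_derivative_from_quotient_family[of Z "\<lambda>t h. Y t (?v h)" t] this t
  show ?thesis by simp
qed

text \<open>\<open>Z i\<close> is the \<open>i\<close>-th column of the Jacobian of the flow. The
  coefficients \<open>D j t (Y t u)\<close> of its equation are of class \<open>k\<close> if
  \<open>Y\<close> is, and therefore so is \<open>Z i\<close>: this is the gain of one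
  order.\<close>

lemma flow_jacobian:
  assumes D: "\<And>i. C_space k {0..} (D i)"
    and FD: "\<And>t u. t \<in> {0..} \<Longrightarrow> (F t has_derivative (\<lambda>h. \<Sum>i\<in>UNIV. h $ i *\<^sub>R D i t u)) (at u)"
    and Yk: "C_space k {0..} Y"
  shows "\<exists>Z. (\<forall>i u. Z i 0 u = axis i 1 \<and>
      is_solution {0..} (\<lambda>t x. \<Sum>j\<in>UNIV. x $ j *\<^sub>R D j t (Y t u)) (\<lambda>t. Z i t u)) \<and>
    (\<forall>i. C_space k {0..} (Z i)) \<and>
    (\<forall>i t u. t \<ge> 0 \<longrightarrow> ((\<lambda>h. Y t (u + h *\<^sub>R axis i 1)) has_vector_derivative Z i t u) (at 0))"
proof -
  let ?b = "\<lambda>j t u. D j t (Y t u)"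
  have bk: "C_space k {0..} (?b j)" for j by (rule C_space_compose[OF D Yk])
  have D0: "C_space 0 {0..} (D i)" for i by (rule C_space_mono[OF le0 D])
  have bL: "norm (\<Sum>j\<in>UNIV. z $ j *\<^sub>R ?b j t u) \<le> L * norm z" if "t \<ge> 0" for t u z
    by (rule derivative_sum_bound[OF D0 FD]) (use that lip in auto)
  have "\<exists>Z. (\<forall>u. Z 0 u = axis i 1) \<and>
    (\<forall>u. is_solution {0..} (\<lambda>t x. (\<Sum>j\<in>UNIV. x $ j *\<^sub>R ?b j t u) + 0) (\<lambda>t. Z t u))" for i
  proof -
    have "continuous_on ({0..} \<times> (UNIV :: (real ^ 'n) set)) (\<lambda>(t :: real, u). 0 :: real ^ 'n)"
      by (simp add: case_prod_unfold)
    from linear_ode_exists[OF C_space_continuous[OF bk] this L bL continuous_on_const]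
    show ?thesis by blast
  qed
  then have "\<forall>i. \<exists>Z. (\<forall>u. Z 0 u = axis i 1) \<and>
    (\<forall>u. is_solution {0..} (\<lambda>t x. (\<Sum>j\<in>UNIV. x $ j *\<^sub>R ?b j t u) + 0) (\<lambda>t. Z t u))" by (rule allI)
  from choice[OF this] obtain Z where Z: "\<And>i u. Z i 0 u = axis i 1"
    "\<And>i u. is_solution {0..} (\<lambda>t x. (\<Sum>j\<in>UNIV. x $ j *\<^sub>R ?b j t u) + 0) (\<lambda>t. Z i t u)"
    by blast
  have Zk: "C_space k {0..} (Z i)" for i
  proof (rule C_space_linear_ode[OF L bL bk C_space_zero _ Z(2)])
    have "Z i 0 = (\<lambda>u. axis i 1)" by (rule ext) (rule Z(1))
    then show "C_space k {0..} (\<lambda>t. Z i 0)" by (simp add: C_space_time)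
  qed
  have Zs: "is_solution {0..} (\<lambda>t x. \<Sum>j\<in>UNIV. x $ j *\<^sub>R ?b j t u) (\<lambda>t. Z i t u)" for i u
    using Z(2)[of u i] by simp
  show ?thesis
    using Z(1) Zs Zk flow_partial_derivative[OF D0 FD Z(1) Zs] by (intro exI[of _ Z]) simp
qed

lemma C_space_flow:
  assumes F: "C_space r {0..} F"
  shows "C_space r {0..} Y"
proof -
  have "k \<le> r \<Longrightarrow> C_space k {0..} Y" for k
  proof (induction k)
    case 0
    show ?case by (rule flow_continuous)
  next
    case (Suc k)
    have "C_space (Suc k) {0..} F" by (rule C_space_mono[OF Suc.prems F])
    then obtain D where D: "\<And>i. C_space k {0..} (D i)"
      "\<And>t u. t \<in> {0..} \<Longrightarrow> (F t has_derivative (\<lambda>h. \<Sum>i\<in>UNIV. h $ i *\<^sub>R D i t u)) (at u)"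
      by (rule C_space_SucE) blast
    have "C_space k {0..} Y" using Suc by simp
    from flow_jacobian[OF D this] obtain Z where "\<And>i u. Z i 0 u = axis i 1"
      "\<And>i u. is_solution {0..} (\<lambda>t x. \<Sum>j\<in>UNIV. x $ j *\<^sub>R D j t (Y t u)) (\<lambda>t. Z i t u)"
      "\<And>i. C_space k {0..} (Z i)"
      "\<And>i t u. t \<ge> 0 \<Longrightarrow> ((\<lambda>h. Y t (u + h *\<^sub>R axis i 1)) has_vector_derivative Z i t u) (at 0)"
      by blast
    then show ?case by (intro C_space_SucI[OF flow_continuous]) auto
  qed
  then show ?thesis by simp
qed

lemma flow_separation:
  assumes "t \<ge> 0"
  shows "norm (u - v) \<le> exp (L * t) * norm (Y t u - Y t v)"
  using lipschitz_solutions_separation(2)[OF lip Y_sol Y_sol assms, of u v] by (simp add: Y_init)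

text \<open>The image of the time-\<open>t\<close> map is open by invariance of domain, and closed because the inverse is
  Lipschitz.\<close>

lemma bij_flow:
  assumes t: "t \<ge> 0"
  shows "bij (Y t)"
proof -
  have inj: "inj (Y t)"
  proof (rule injI)
    fix u v assume "Y t u = Y t v"
    with flow_separation[OF t, of u v] show "u = v" by simp
  qed
  have cont: "continuous_on UNIV (Y t)"
    by (rule C_space_compose_continuous[OF flow_continuous]) (use t in auto)
  have "open (range (Y t))" by (rule invariance_of_domain[OF cont open_UNIV inj])
  moreover have "closed (range (Y t))"
    unfolding closed_sequential_limits
  proof (intro allI impI, elim conjE)
    fix y l assume y: "\<forall>n. y n \<in> range (Y t)" and l: "y \<longlonglongrightarrow> l"
    from y have "\<forall>n. \<exists>x. y n = Y t x" by blast
    from choice[OF this] obtain x where x: "\<And>n. y n = Y t (x n)" by blast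
    have "Cauchy x"
    proof (rule metric_CauchyI)
      fix e :: real assume "e > 0"
      then have "e / exp (L * t) > 0" by simp
      from metric_CauchyD[OF LIMSEQ_imp_Cauchy[OF l] this]
      obtain M where M: "\<And>m n. m \<ge> M \<Longrightarrow> n \<ge> M \<Longrightarrow> dist (y m) (y n) < e / exp (L * t)" by blast
      have "dist (x m) (x n) < e" if "m \<ge> M" "n \<ge> M" for m n
      proof -
        have "dist (x m) (x n) \<le> exp (L * t) * dist (y m) (y n)"
          using flow_separation[OF t] by (simp add: dist_norm x)
        also have "\<dots> < e" using M[OF that] by (simp add: field_simps)
        finally show ?thesis .
      qed
      then show "\<exists>M. \<forall>m\<ge>M. \<forall>n\<ge>M. dist (x m) (x n) < e" by blast
    qed
    then obtain a where a: "x \<longlonglongrightarrow> a"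
      unfolding Cauchy_convergent_iff convergent_LIMSEQ_iff by (rule that)
    have "(\<lambda>n. Y t (x n)) \<longlonglongrightarrow> Y t a"
      by (rule continuous_on_tendsto_compose[OF cont a]) auto
    then have "y \<longlonglongrightarrow> Y t a" by (simp add: x[symmetric])
    with l have "l = Y t a" by (rule LIMSEQ_unique)
    then show "l \<in> range (Y t)" by simp
  qed
  ultimately have "range (Y t) = UNIV"
    using clopen[of "range (Y t)"] by auto
  with inj show ?thesis by (simp add: bij_def)
qed

text \<open>Let \<open>u\<close> be the value of \<open>V\<close> at the limit point
  \<open>z\<close>. At a nearby point \<open>w\<close> the backward estimate bounds the distance of
  the value of \<open>V\<close> from \<open>u\<close> by \<open>?e w\<close>, an expression in the
  trajectory of the fixed point \<open>u\<close>, which is continuous in \<open>w\<close> and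
  vanishes at \<open>z\<close>.\<close>

lemma inverse_flow_continuous:
  assumes V: "\<And>t v. t \<ge> 0 \<Longrightarrow> Y t (V t v) = v"
  shows "C_space 0 {0..} V"
proof -
  have "continuous (at z within {0..} \<times> UNIV) (\<lambda>(t, v). V t v)" if z: "z \<in> {0..} \<times> UNIV" for z
  proof -
    define u where "u = V (fst z) (snd z)"
    have t: "fst z \<ge> 0" using z by auto
    let ?e = "\<lambda>w. exp (L * fst w) * norm (Y (fst w) u - snd w)"
    have "continuous_on ({0..} \<times> UNIV) ?e"
      by (intro continuous_intros C_space_compose_continuous[OF flow_continuous]) auto
    then have "(?e \<longlongrightarrow> ?e z) (at z within {0..} \<times> UNIV)"
      using z unfolding continuous_on_def by blast
    moreover have "?e z = 0" using V[OF t, of "snd z"] by (simp add: u_def)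
    ultimately have lim: "(?e \<longlongrightarrow> 0) (at z within {0..} \<times> UNIV)" by simp
    have "((\<lambda>w. V (fst w) (snd w) - u) \<longlongrightarrow> 0) (at z within {0..} \<times> UNIV)"
    proof (rule Lim_null_comparison[OF _ lim])
      have "norm (V (fst w) (snd w) - u) \<le> ?e w" if "w \<in> {0..} \<times> UNIV" for w
      proof -
        have w: "fst w \<ge> 0" using that by auto
        from flow_separation[OF w, of "V (fst w) (snd w)" u] show ?thesis
          by (simp add: V[OF w] norm_minus_commute)
      qed
      then show "\<forall>\<^sub>F w in at z within {0..} \<times> UNIV. norm (V (fst w) (snd w) - u) \<le> ?e w"
        by (auto simp: eventually_at_filter)
    qed
    then show ?thesis
      by (simp add: continuous_within case_prod_unfold u_def LIM_zero_iff)
  qed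
  then show ?thesis by (simp add: continuous_on_eq_continuous_within)
qed

text \<open>The rows of the inverse Jacobian solve the adjoint of the variational equation.\<close>

lemma C_space_inverse_flow:
  assumes F: "C_space r {0..} F" and V: "\<And>t v. t \<ge> 0 \<Longrightarrow> Y t (V t v) = v"
  shows "C_space r {0..} V"
proof -
  have "k \<le> r \<Longrightarrow> C_space k {0..} V" for k
  proof (induction k)
    case 0
    show ?case by (rule inverse_flow_continuous[OF V])
  next
    case (Suc k)
    have "C_space (Suc k) {0..} F" by (rule C_space_mono[OF Suc.prems F])
    then obtain D where D: "\<And>i. C_space k {0..} (D i)"
      "\<And>t u. t \<in> {0..} \<Longrightarrow> (F t has_derivative (\<lambda>h. \<Sum>i\<in>UNIV. h $ i *\<^sub>R D i t u)) (at u)"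
      by (rule C_space_SucE) blast
    have Vk: "C_space k {0..} V" using Suc by simp
    have Yk: "C_space k {0..} Y"
      using C_space_mono[OF _ C_space_flow[OF F]] Suc.prems by simp
    from flow_jacobian[OF D Yk] obtain Z where Z: "\<And>i u. Z i 0 u = axis i 1"
      "\<And>i u. is_solution {0..} (\<lambda>t x. \<Sum>j\<in>UNIV. x $ j *\<^sub>R D j t (Y t u)) (\<lambda>t. Z i t u)"
      "\<And>i. C_space k {0..} (Z i)"
      "\<And>i t u. t \<ge> 0 \<Longrightarrow> ((\<lambda>h. Y t (u + h *\<^sub>R axis i 1)) has_vector_derivative Z i t u) (at 0)"
      by blast
    have Yder: "(Y t has_derivative (\<lambda>h. \<Sum>i\<in>UNIV. h $ i *\<^sub>R Z i t u)) (at u)" if t: "t \<ge> 0" for t u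
      by (rule has_derivative_if_continuous_partials[OF Z(4)[OF t]
            C_space_compose_continuous[OF C_space_mono[OF le0 Z(3)]]]) (use t in auto)
    define b where "b j t u = D j t (Y t u)" for j t u
    \<comment> \<open>If \<open>b\<close> lists the columns of the variational matrix,
      \<open>a\<close> lists the columns of minus its transpose.\<close>
    define a where "a l t u = - (\<Sum>j\<in>UNIV. (b j t u $ l) *\<^sub>R axis j (1::real))" for l t u
    have bk: "C_space k {0..} (b j)" for j unfolding b_def by (rule C_space_compose[OF D(1) Yk])
    have ak: "C_space k {0..} (a l)" for l
      unfolding a_def
      by (intro C_space_bounded_linear[OF bounded_linear_minus[OF bounded_linear_ident]]
          C_space_sum C_space_scaleR C_space_nth bk C_space_time continuous_intros)
    have bL: "norm (\<Sum>j\<in>UNIV. z $ j *\<^sub>R b j t u) \<le> L * norm z" if "t \<ge> 0" for t u z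
      unfolding b_def by (rule derivative_sum_bound[OF C_space_mono[OF le0 D(1)] D(2)]) (use that lip in auto)
    have adj: "(\<Sum>l\<in>UNIV. w $ l *\<^sub>R a l t u) = (\<chi> j. - (w \<bullet> b j t u))" for w t u
    proof (subst vec_eq_iff, intro allI)
      fix i
      have "(\<Sum>j\<in>UNIV. (b j t u $ l) * (axis j 1 $ i)) = b i t u $ l" for l
      proof -
        have "(\<Sum>j\<in>UNIV. (b j t u $ l) * (axis j 1 $ i)) = (\<Sum>j\<in>UNIV. if j = i then b j t u $ l else 0)"
          by (intro sum.cong) (auto simp: axis_def)
        then show ?thesis by simp
      qed
      then show "(\<Sum>l\<in>UNIV. w $ l *\<^sub>R a l t u) $ i = (\<chi> j. - (w \<bullet> b j t u)) $ i"
        by (simp add: a_def inner_vec_def sum_negf)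
    qed
    \<comment> \<open>The transpose has the same operator norm: pairing \<open>x\<close> with itself
      moves the matrix back onto \<open>x\<close>, and one factor \<open>norm x\<close>
      cancels.\<close>
    have aL: "norm (\<Sum>l\<in>UNIV. w $ l *\<^sub>R a l t u) \<le> L * norm w" if t: "t \<ge> 0" for t u w
    proof -
      define x where "x = (\<Sum>l\<in>UNIV. w $ l *\<^sub>R a l t u)"
      have "x \<bullet> x = - (w \<bullet> (\<Sum>j\<in>UNIV. x $ j *\<^sub>R b j t u))"
        by (subst inner_vec_def) (simp add: x_def adj inner_sum_right sum_negf mult.commute)
      also have "\<dots> \<le> norm w * norm (\<Sum>j\<in>UNIV. x $ j *\<^sub>R b j t u)"
        using Cauchy_Schwarz_ineq2[of w "\<Sum>j\<in>UNIV. x $ j *\<^sub>R b j t u"] by simp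
      also have "\<dots> \<le> norm w * (L * norm x)" by (intro mult_left_mono bL t) simp
      finally have "norm x * norm x \<le> (L * norm w) * norm x"
        by (simp add: power2_norm_eq_inner[symmetric] power2_eq_square mult_ac)
      then have "norm x \<le> L * norm w"
        using L by (cases "x = 0") (auto simp: mult_le_cancel_right)
      then show ?thesis by (simp add: x_def)
    qed
    have "\<exists>W. (\<forall>u. W 0 u = axis i 1) \<and>
      (\<forall>u. is_solution {0..} (\<lambda>t x. (\<Sum>j\<in>UNIV. x $ j *\<^sub>R a j t u) + 0) (\<lambda>t. W t u))" for i
    proof -
      have "continuous_on ({0..} \<times> (UNIV :: (real ^ 'n) set)) (\<lambda>(t :: real, u). 0 :: real ^ 'n)"
        by (simp add: case_prod_unfold)
      from linear_ode_exists[OF C_space_continuous[OF ak] this L aL continuous_on_const]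
      show ?thesis by blast
    qed
    then have "\<forall>i. \<exists>W. (\<forall>u. W 0 u = axis i 1) \<and>
      (\<forall>u. is_solution {0..} (\<lambda>t x. (\<Sum>j\<in>UNIV. x $ j *\<^sub>R a j t u) + 0) (\<lambda>t. W t u))" by (rule allI)
    from choice[OF this] obtain W where W: "\<And>i u. W i 0 u = axis i 1"
      "\<And>i u. is_solution {0..} (\<lambda>t x. (\<Sum>j\<in>UNIV. x $ j *\<^sub>R a j t u) + 0) (\<lambda>t. W i t u)"
      by blast
    have Wk: "C_space k {0..} (W i)" for i
    proof (rule C_space_linear_ode[OF L aL ak C_space_zero _ W(2)])
      have "W i 0 = (\<lambda>u. axis i 1)" by (rule ext) (rule W(1))
      then show "C_space k {0..} (\<lambda>t. W i 0)" by (simp add: C_space_time)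
    qed
    \<comment> \<open>The adjoint equation makes the two terms of the product rule cancel, so the
      inner product keeps its initial value. Hence the \<open>W l\<close> are the rows of a left
      inverse of the Jacobian with columns \<open>Z i\<close>.\<close>
    have WZ: "W l t u \<bullet> Z i t u = (if l = i then 1 else 0)" if t: "t \<ge> 0" for l i t u
    proof -
      have "((\<lambda>t. W l t u \<bullet> Z i t u) has_derivative (\<lambda>h. 0)) (at s within {0..})" if s: "s \<in> {0..}" for s
      proof -
        let ?w = "W l s u" and ?z = "Z i s u"
        have "((\<lambda>t. W l t u) has_derivative (\<lambda>h. h *\<^sub>R (\<chi> j. - (?w \<bullet> b j s u)))) (at s within {0..})"
          using W(2)[of u l] s by (simp add: is_solution_def has_vector_derivative_def adj)
        moreover have "((\<lambda>t. Z i t u) has_derivative (\<lambda>h. h *\<^sub>R (\<Sum>j\<in>UNIV. ?z $ j *\<^sub>R b j s u))) (at s within {0..})"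
          using Z(2)[of u i] s by (simp add: is_solution_def has_vector_derivative_def b_def)
        moreover have "(\<chi> j. - (?w \<bullet> b j s u)) \<bullet> ?z = - (?w \<bullet> (\<Sum>j\<in>UNIV. ?z $ j *\<^sub>R b j s u))"
          by (simp add: inner_vec_def[of "\<chi> j. - (?w \<bullet> b j s u)"] inner_sum_right sum_negf mult.commute)
        ultimately show ?thesis
          by (intro has_derivative_eq_rhs[OF has_derivative_inner]) (auto simp: fun_eq_iff)
      qed
      from has_derivative_zero_constant[OF _ this]
      obtain c where "\<forall>s\<in>{0..}. W l s u \<bullet> Z i s u = c" by auto
      then have c: "W l s u \<bullet> Z i s u = c" if "s \<ge> 0" for s using that by simp
      have "W l t u \<bullet> Z i t u = W l 0 u \<bullet> Z i 0 u" using c[of t] c[of 0] t by simp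
      then show ?thesis by (simp add: W(1) Z(1) inner_axis_axis)
    qed
    \<comment> \<open>\<open>N i\<close> is the \<open>i\<close>-th column of the matrix whose rows
      are the \<open>W l\<close>.\<close>
    define N where "N i t u = (\<Sum>l\<in>UNIV. (W l t u $ i) *\<^sub>R axis l (1::real))" for i t u
    have Nk: "C_space k {0..} (N i)" for i
      unfolding N_def by (intro C_space_sum C_space_scaleR C_space_nth Wk C_space_time continuous_intros)
    show ?case
    \<comment> \<open>The derivative of \<open>V\<close> is the inverse Jacobian evaluated at
      \<open>V t v\<close>. It is of class \<open>k\<close> because \<open>V\<close> already is, and
      this raises \<open>V\<close> to class \<open>Suc k\<close>.\<close>
    proof (rule C_space_SucI_derivative[of _ _ _ "\<lambda>i t v. N i t (V t v)"])
      show "C_space 0 {0..} V" by (rule C_space_mono[OF le0 Vk])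
      show "C_space k {0..} (\<lambda>t v. N i t (V t v))" for i by (rule C_space_compose[OF Nk Vk])
      fix t :: real and v assume "t \<in> {0..}"
      then have t: "t \<ge> 0" by simp
      let ?g = "\<lambda>h. \<Sum>i\<in>UNIV. h $ i *\<^sub>R N i t (V t v)"
      have g: "?g h $ l = W l t (V t v) \<bullet> h" for h l
      proof -
        have "N i t (V t v) $ l = W l t (V t v) $ i" for i
        proof -
          have "N i t (V t v) $ l = (\<Sum>m\<in>UNIV. if m = l then W m t (V t v) $ i else 0)"
            unfolding N_def sum_component by (intro sum.cong) (auto simp: axis_def)
          then show ?thesis by simp
        qed
        then show ?thesis by (simp add: inner_vec_def mult.commute)
      qed
      show "(V t has_derivative ?g) (at v)"
      proof (rule has_derivative_inverse_basic[OF Yder[OF t] _ _ _ open_UNIV UNIV_I V[OF t]])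
        show "bounded_linear ?g"
          by (intro bounded_linear_sum bounded_linear_scaleR_const bounded_linear_vec_nth)
        show "?g \<circ> (\<lambda>h. \<Sum>i\<in>UNIV. h $ i *\<^sub>R Z i t (V t v)) = id"
          by (rule ext, subst vec_eq_iff, intro allI, simp only: o_apply g)
            (simp add: inner_sum_right WZ[OF t] if_distrib cong: if_cong)
        have "continuous_on UNIV (V t)"
          by (rule C_space_compose_continuous[OF C_space_mono[OF le0 Vk]]) (use t in auto)
        then show "continuous (at v) (V t)" by (simp add: continuous_on_eq_continuous_at)
      qed
    qed
  qed
  then show ?thesis by simp
qed

end

proposition C_space_lipschitz_flow:
  fixes F :: "real \<Rightarrow> real ^ 'n \<Rightarrow> real ^ 'n"
  assumes F: "C_space r {0..} F" and L: "L > 0"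
    and lip: "\<And>t x y. t \<ge> 0 \<Longrightarrow> norm (F t x - F t y) \<le> L * norm (x - y)"
  shows "\<exists>Y. (\<forall>u. Y 0 u = u) \<and> (\<forall>u. is_solution {0..} F (\<lambda>t. Y t u)) \<and>
    (\<forall>t\<ge>0. bij (Y t)) \<and> C_space r {0..} Y \<and> C_space r {0..} (\<lambda>t. inv (Y t))"
proof -
  have F0: "C_space 0 {0..} F" by (rule C_space_mono[OF le0 F])
  have "continuous_on ({0..} \<times> UNIV) (\<lambda>(t, p, x). F t x)"
    unfolding case_prod_unfold
    by (rule C_space_compose_continuous[OF F0]) (auto intro!: continuous_intros)
  from lipschitz_ode_exists[OF this lip L continuous_on_id]
  obtain Y where Y: "\<And>u. Y 0 u = u" "\<And>u. is_solution {0..} F (\<lambda>t. Y t u)" by blast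
  note flow = F0 lip L Y
  have "Y t (inv (Y t) v) = v" if "t \<ge> 0" for t v
    using bij_flow[OF flow that] by (simp add: bij_is_surj surj_f_inv_f)
  from C_space_inverse_flow[OF flow F this] C_space_flow[OF flow F] bij_flow[OF flow] Y
  show ?thesis by (intro exI[of _ Y]) simp
qed

section \<open>Conjugating two systems by their flows\<close>

lemma flow_of_solution:
  assumes lip: "\<And>t x y. t \<ge> 0 \<Longrightarrow> norm (F t x - F t y) \<le> L * norm (x - y)"
    and Y: "\<And>u. Y 0 u = u" "\<And>u. is_solution {0..} F (\<lambda>t. Y t u)"
    and x: "is_solution {0..} F x" and t: "t \<ge> 0"
  shows "x t = Y t (x 0)"
  by (rule lipschitz_solution_unique[OF lip x Y(2) _ t]) (simp_all add: Y(1))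

text \<open>\<open>inv (Y t)\<close> traces \<open>x t\<close> back to \<open>x 0\<close>, and
  \<open>Y' t\<close> carries \<open>x 0\<close> forward along the other system, so the image is the
  solution with the same initial value.\<close>

lemma maps_solutions_flow:
  assumes lip: "\<And>t x y. t \<ge> 0 \<Longrightarrow> norm (F t x - F t y) \<le> L * norm (x - y)"
    and Y: "\<And>u. Y 0 u = u" "\<And>u. is_solution {0..} F (\<lambda>t. Y t u)" "\<And>t. t \<ge> 0 \<Longrightarrow> bij (Y t)"
    and Y': "\<And>u. is_solution {0..} F' (\<lambda>t. Y' t u)"
  shows "maps_solutions {0..} F F' (\<lambda>t. Y' t \<circ> inv (Y t))"
  unfolding maps_solutions_def
proof (intro allI impI)
  fix x assume x: "is_solution {0..} F x"
  have "(Y' t \<circ> inv (Y t)) (x t) = Y' t (x 0)" if "t \<in> {0..}" for t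
    using flow_of_solution[OF lip Y(1,2) x, of t] Y(3)[of t] that
    by (simp add: bij_is_inj)
  then show "is_solution {0..} F' (\<lambda>t. (Y' t \<circ> inv (Y t)) (x t))"
    using Y'[of "x 0"] is_solution_cong[of "{0..}" "\<lambda>t. (Y' t \<circ> inv (Y t)) (x t)" "\<lambda>t. Y' t (x 0)" F'] by blast
qed

text \<open>At a point \<open>u = Y t w\<close> the displacement is \<open>Y' t w - Y t w\<close>,
  so closeness of the two flows from a common initial value bounds it uniformly.\<close>

lemma near_identity_homeo_flow:
  assumes Y: "\<And>t. t \<ge> 0 \<Longrightarrow> bij (Y t)" "\<And>t. t \<ge> 0 \<Longrightarrow> bij (Y' t)"
    and C: "C_space 0 {0..} (\<lambda>t. Y' t \<circ> inv (Y t))" "C_space 0 {0..} (\<lambda>t. Y t \<circ> inv (Y' t))"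
    and close: "\<And>t u. t \<ge> 0 \<Longrightarrow> norm (Y' t u - Y t u) \<le> B"
  shows "near_identity_homeo {0..} (\<lambda>t. Y' t \<circ> inv (Y t))"
  unfolding near_identity_homeo_def
proof (intro conjI ballI)
  have "norm ((Y' t \<circ> inv (Y t)) u - u) \<le> B" if "t \<ge> 0" for t u
    using close[OF that, of "inv (Y t) u"] Y(1)[OF that] by (simp add: bij_is_surj surj_f_inv_f)
  then show "bounded ((\<lambda>(t, u). (Y' t \<circ> inv (Y t)) u - u) ` ({0..} \<times> UNIV))"
    unfolding bounded_iff by auto
  show "continuous_on ({0..} \<times> UNIV) (\<lambda>(t, u). (Y' t \<circ> inv (Y t)) u)"
    by (rule C_space_continuous[OF C(1)])
  fix t :: real assume t: "t \<in> {0..}"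
  have "continuous_on UNIV (\<lambda>u. (Y' t \<circ> inv (Y t)) u)" "continuous_on UNIV (\<lambda>u. (Y t \<circ> inv (Y' t)) u)"
    by (rule C_space_compose_continuous[OF C(1)] C_space_compose_continuous[OF C(2)];
        use t in \<open>auto intro: continuous_on_id\<close>)+
  then have "homeomorphism UNIV UNIV (Y' t \<circ> inv (Y t)) (Y t \<circ> inv (Y' t))"
    using Y[of t] t by (intro homeomorphismI) (auto simp: bij_is_surj bij_is_inj surj_f_inv_f)
  then show "\<exists>g. homeomorphism UNIV UNIV (Y' t \<circ> inv (Y t)) g" by blast
qed

text \<open>Stability is abstracted into \<open>close\<close>, which is symmetric in the two systems
  and so bounds the displacement of both \<open>H\<close> and \<open>G\<close> by
  \<open>B\<close>.\<close>

proposition C_equivalence_of_lipschitz_systems: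
  fixes F F' :: "real \<Rightarrow> real ^ 'n \<Rightarrow> real ^ 'n"
  assumes C: "C_space r {0..} F" "C_space r {0..} F'" and L: "L > 0"
    and lip: "\<And>t x y. t \<ge> 0 \<Longrightarrow> norm (F t x - F t y) \<le> L * norm (x - y)"
    and lip': "\<And>t x y. t \<ge> 0 \<Longrightarrow> norm (F' t x - F' t y) \<le> L * norm (x - y)"
    and close: "\<And>x y t. is_solution {0..} F x \<Longrightarrow> is_solution {0..} F' y \<Longrightarrow> x 0 = y 0 \<Longrightarrow> t \<ge> 0 \<Longrightarrow>
      norm (y t - x t) \<le> B"
  shows "C_continuously_topologically_equivalent r {0..} F F'"
proof -
  obtain Y where Y: "\<And>u. Y 0 u = u" "\<And>u. is_solution {0..} F (\<lambda>t. Y t u)"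
    "\<And>t. t \<ge> 0 \<Longrightarrow> bij (Y t)" "C_space r {0..} Y" "C_space r {0..} (\<lambda>t. inv (Y t))"
    using C_space_lipschitz_flow[OF C(1) L lip] by blast
  obtain Y' where Y': "\<And>u. Y' 0 u = u" "\<And>u. is_solution {0..} F' (\<lambda>t. Y' t u)"
    "\<And>t. t \<ge> 0 \<Longrightarrow> bij (Y' t)" "C_space r {0..} Y'" "C_space r {0..} (\<lambda>t. inv (Y' t))"
    using C_space_lipschitz_flow[OF C(2) L lip'] by blast
  define H where "H t = Y' t \<circ> inv (Y t)" for t
  define G where "G t = Y t \<circ> inv (Y' t)" for t
  have HG: "C_space r {0..} H" "C_space r {0..} G"
    unfolding H_def G_def comp_def
    by (rule C_space_compose[OF Y'(4) Y(5)], rule C_space_compose[OF Y(4) Y'(5)])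
  have near: "norm (Y' t u - Y t u) \<le> B" "norm (Y t u - Y' t u) \<le> B" if "t \<ge> 0" for t u
    using close[OF Y(2) Y'(2) _ that, of u u] Y(1) Y'(1) by (simp_all add: norm_minus_commute)
  have HG0: "C_space 0 {0..} H" "C_space 0 {0..} G" using HG[THEN C_space_mono[OF le0]] .
  have bij: "bij (H t)" if "t \<ge> 0" for t
    using Y(3)[OF that] Y'(3)[OF that] unfolding H_def by (intro bij_comp bij_imp_bij_inv)
  have inv: "G t = inv (H t)" if "t \<ge> 0" for t
    using Y(3)[OF that] Y'(3)[OF that]
    by (simp add: H_def G_def o_inv_distrib bij_imp_bij_inv inv_inv_eq)
  have "topological_equivalence {0..} F F' H G"
    unfolding topological_equivalence_def
  proof (intro conjI ballI)
    show "maps_solutions {0..} F F' H"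
      unfolding H_def by (rule maps_solutions_flow[OF lip Y(1-3) Y'(2)])
    show "maps_solutions {0..} F' F G"
      unfolding G_def by (rule maps_solutions_flow[OF lip' Y'(1-3) Y(2)])
    show "near_identity_homeo {0..} H"
      unfolding H_def by (rule near_identity_homeo_flow[OF Y(3) Y'(3) HG0[unfolded H_def G_def] near(1)])
    show "near_identity_homeo {0..} G"
      unfolding G_def by (rule near_identity_homeo_flow[OF Y'(3) Y(3) HG0(2,1)[unfolded H_def G_def] near(2)])
  qed (use inv in auto)
  moreover have "C_diffeomorphism r (H t)" if "t \<in> {0..}" for t
    using HG[THEN C_space_iff_space_derivs_continuous[THEN iffD1], THEN space_derivs_continuous_imp_C_map, OF that]
      bij[of t] inv[of t] that by (simp add: C_diffeomorphism_def)
  moreover have "is_interval {0::real..}" by (rule is_interval_ci)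
  ultimately show ?thesis
    using HG unfolding C_continuously_topologically_equivalent_def C_space_iff_space_derivs_continuous
    by blast
qed

section \<open>Equivalence of norms and the operator norm\<close>

lemma is_norm_equivalent:
  fixes nm :: "real ^ 'n \<Rightarrow> real"
  assumes nm: "is_norm nm"
  shows "\<exists>c C. c > 0 \<and> C > 0 \<and> (\<forall>x. norm x \<le> c * nm x \<and> nm x \<le> C * norm x)"
proof -
  have nn: "0 \<le> nm x" and zero: "nm x = 0 \<longleftrightarrow> x = 0" and scale: "nm (a *\<^sub>R x) = \<bar>a\<bar> * nm x"
    and tri: "nm (x + y) \<le> nm x + nm y" for a x y
    using nm by (auto simp: is_norm_def)
  \<comment> \<open>Expansion in the standard basis bounds \<open>nm x\<close> by the sum times
    \<open>norm x\<close>; the summand 1 makes \<open>C\<close> positive.\<close>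
  define C where "C = 1 + (\<Sum>i\<in>UNIV. nm (axis i (1::real)))"
  have C: "C > 0" unfolding C_def using sum_nonneg[of UNIV "\<lambda>i. nm (axis i 1)"] nn by simp
  have sum_le: "nm (\<Sum>i\<in>S. g i) \<le> (\<Sum>i\<in>S. nm (g i))" if "finite S" for S and g :: "'n \<Rightarrow> real ^ 'n"
    using that
  proof (induction S rule: finite_induct)
    case empty
    show ?case using zero[of 0] by simp
  next
    case (insert i S)
    then show ?case using tri[of "g i" "\<Sum>i\<in>S. g i"] by simp
  qed
  have upper: "nm x \<le> C * norm x" for x
  proof -
    have "nm x = nm (\<Sum>i\<in>UNIV. x $ i *\<^sub>R axis i 1)"
      by (simp add: basis_expansion scalar_mult_eq_scaleR[symmetric])
    also have "\<dots> \<le> (\<Sum>i\<in>UNIV. nm (x $ i *\<^sub>R axis i 1))" by (rule sum_le) simp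
    also have "\<dots> \<le> (\<Sum>i\<in>UNIV. norm x * nm (axis i 1))"
      unfolding scale by (intro sum_mono mult_right_mono nn component_le_norm_cart)
    also have "\<dots> \<le> C * norm x" by (simp add: C_def sum_distrib_left algebra_simps)
    finally show ?thesis .
  qed
  have diff: "\<bar>nm x - nm y\<bar> \<le> C * norm (x - y)" for x y
  proof -
    have "nm x \<le> nm (x - y) + nm y" "nm y \<le> nm (y - x) + nm x"
      using tri[of "x - y" y] tri[of "y - x" x] by simp_all
    then show ?thesis using upper[of "x - y"] upper[of "y - x"] by (simp add: norm_minus_commute)
  qed
  have cont: "continuous_on S nm" for S
    unfolding continuous_on_iff
  proof (intro ballI allI impI)
    fix x and e :: real assume "e > 0"
    then have "e / C > 0" using C by simp
    moreover have "dist (nm y) (nm x) < e" if "dist y x < e / C" for y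
      using diff[of y x] that C by (simp add: dist_norm dist_real_def field_simps)
    ultimately show "\<exists>d>0. \<forall>y\<in>S. dist y x < d \<longrightarrow> dist (nm y) (nm x) < e" by blast
  qed
  have "axis undefined 1 \<in> sphere (0 :: real ^ 'n) 1" by (simp add: norm_axis_1)
  then have "sphere (0 :: real ^ 'n) 1 \<noteq> {}" by blast
  \<comment> \<open>The minimum of \<open>nm\<close> on the compact unit sphere is positive, and
    homogeneity extends the resulting lower bound to all vectors.\<close>
  from continuous_attains_inf[OF compact_sphere this cont]
  obtain a where a: "a \<in> sphere (0 :: real ^ 'n) 1" "\<And>y. y \<in> sphere 0 1 \<Longrightarrow> nm a \<le> nm y" by blast
  have "a \<noteq> 0" using a(1) by auto
  then have pos: "nm a > 0" using nn[of a] zero[of a] by linarith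
  have "norm x \<le> (1 / nm a) * nm x" for x
  proof (cases "x = 0")
    case False
    have "nm a \<le> nm ((1 / norm x) *\<^sub>R x)" using False by (intro a(2)) simp
    then show ?thesis using False pos by (simp add: scale field_simps)
  qed (simp add: nn)
  with pos C upper show ?thesis by (intro exI[of _ "1 / nm a"] exI[of _ C]) simp
qed

text \<open>The supremum is an upper bound once the quotients are known to be bounded, which follows
  by comparison with the Euclidean norm. At \<open>x = 0\<close> both sides vanish.\<close>

lemma operator_norm_bound:
  fixes nm :: "real ^ 'n \<Rightarrow> real"
  assumes nm: "is_norm nm"
  shows "nm (B *v x) \<le> operator_norm nm B * nm x"
proof -
  obtain c C where c: "c > 0" "C > 0" "\<And>x. norm x \<le> c * nm x" "\<And>x. nm x \<le> C * norm x"
    using is_norm_equivalent[OF nm] by blast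
  have nn: "0 \<le> nm x" and zero: "nm x = 0 \<longleftrightarrow> x = 0" for x using nm by (auto simp: is_norm_def)
  obtain k where k: "k > 0" "\<And>x. norm (B *v x) \<le> norm x * k"
    using bounded_linear.pos_bounded[OF matrix_vector_mul_bounded_linear[of B]] by blast
  have "nm (B *v y) / nm y \<le> C * (c * k)" for y
  proof (cases "y = 0")
    case False
    then have pos: "nm y > 0" using nn[of y] zero[of y] by linarith
    have "nm (B *v y) \<le> C * norm (B *v y)" by (rule c(4))
    also have "\<dots> \<le> C * (norm y * k)" using c(2) k(2) by (intro mult_left_mono) auto
    also have "\<dots> \<le> C * ((c * nm y) * k)" using c k by (intro mult_left_mono mult_right_mono) auto
    finally show ?thesis using pos by (simp add: field_simps)
  qed (use c k in \<open>simp add: zero\<close>)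
  then have "bdd_above (range (\<lambda>x. nm (B *v x) / nm x))" by (intro bdd_aboveI) auto
  then have le: "nm (B *v x) / nm x \<le> operator_norm nm B"
    unfolding operator_norm_def by (intro cSUP_upper) auto
  show ?thesis
  proof (cases "x = 0")
    case False
    then have "nm x > 0" using nn[of x] zero[of x] by linarith
    then show ?thesis using le by (simp add: field_simps)
  qed (use zero[of 0] in simp)
qed

lemma bounded_bilinear_matrix_vector_mult:
  "bounded_bilinear (\<lambda>(B :: real ^ 'n ^ 'm) x. B *v x)"
  by (simp add: bilinear_conv_bounded_bilinear[symmetric] bilinear_def linear_iff
      matrix_vector_right_distrib matrix_vector_mult_add_rdistrib matrix_vector_mult_scaleR
      scaleR_matrix_vector_assoc)

lemma C_space_linear_system:
  assumes "continuous_on J A"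
  shows "C_space r J (linear_system A)"
proof -
  have "continuous_on J (\<lambda>t. column j (A t))" for j
    unfolding column_def by (intro continuous_intros assms)
  then have "C_space r J (\<lambda>t u. \<Sum>j\<in>UNIV. u $ j *\<^sub>R column j (A t))"
    by (intro C_space_sum C_space_scaleR C_space_nth C_space_id C_space_time)
  then show ?thesis
    by (rule C_space_cong) (simp add: linear_system_def matrix_mult_sum scalar_mult_eq_scaleR)
qed

section \<open>Fundamental matrices and variation of constants\<close>

lemma matrix_inv_cancel:
  assumes "invertible B"
  shows "B *v (matrix_inv B *v x) = x" "matrix_inv B *v (B *v x) = x"
proof -
  have "B ** matrix_inv B = mat 1 \<and> matrix_inv B ** B = mat 1"
    unfolding matrix_inv_def by (rule someI_ex) (use assms in \<open>simp add: invertible_def\<close>)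
  then show "B *v (matrix_inv B *v x) = x" "matrix_inv B *v (B *v x) = x"
    by (simp_all add: matrix_vector_mul_assoc)
qed

lemma fundamental_matrix_solution:
  assumes "fundamental_matrix J A \<Phi>"
  shows "is_solution J (linear_system A) (\<lambda>t. \<Phi> t *v c)"
  unfolding is_solution_def linear_system_def
proof
  fix t assume "t \<in> J"
  then have "(\<Phi> has_vector_derivative A t ** \<Phi> t) (at t within J)"
    using assms by (simp add: fundamental_matrix_def)
  from bounded_linear.has_vector_derivative[OF
      bounded_bilinear.bounded_linear_left[OF bounded_bilinear_matrix_vector_mult] this]
  show "((\<lambda>t. \<Phi> t *v c) has_vector_derivative A t *v (\<Phi> t *v c)) (at t within J)"
    by (simp add: matrix_vector_mul_assoc)
qed

text \<open>The flow of the linear system satisfies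
  \<open>Y t (\<Phi> 0 *v c) = \<Phi> t *v c\<close>, so the inverse of \<open>\<Phi> t\<close> is
  the inverse of \<open>\<Phi> 0\<close> applied after \<open>inv (Y t)\<close>. The joint
  continuity of the inverse flow then gives the claim.\<close>

lemma continuous_on_matrix_inv_fundamental:
  assumes \<Phi>: "fundamental_matrix {0..} A \<Phi>" and A: "continuous_on {0..} A"
    and lip: "\<And>t x y. t \<ge> 0 \<Longrightarrow> norm (A t *v x - A t *v y) \<le> L * norm (x - y)" and L: "L > 0"
    and g: "continuous_on {0..} g"
  shows "continuous_on {0..} (\<lambda>t. matrix_inv (\<Phi> t) *v g t)"
proof -
  have lip': "norm (linear_system A t x - linear_system A t y) \<le> L * norm (x - y)" if "t \<ge> 0" for t x y
    using lip[OF that] by (simp add: linear_system_def)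
  obtain Y where Y: "\<And>u. Y 0 u = u" "\<And>u. is_solution {0..} (linear_system A) (\<lambda>t. Y t u)"
    "\<And>t. t \<ge> 0 \<Longrightarrow> bij (Y t)" "C_space 0 {0..} (\<lambda>t. inv (Y t))"
    using C_space_lipschitz_flow[OF C_space_linear_system[OF A] L lip'] by blast
  have inv: "invertible (\<Phi> t)" if "t \<ge> 0" for t using \<Phi> that by (simp add: fundamental_matrix_def)
  have eq: "matrix_inv (\<Phi> 0) *v (inv (Y t) (g t)) = matrix_inv (\<Phi> t) *v g t" if t: "t \<ge> 0" for t
  proof -
    have "Y t (\<Phi> 0 *v (matrix_inv (\<Phi> t) *v g t)) = \<Phi> t *v (matrix_inv (\<Phi> t) *v g t)"
      using flow_of_solution[OF lip' Y(1,2) fundamental_matrix_solution[OF \<Phi>] t] by metis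
    also have "\<dots> = g t" by (rule matrix_inv_cancel[OF inv[OF t]])
    finally have "inv (Y t) (g t) = \<Phi> 0 *v (matrix_inv (\<Phi> t) *v g t)"
      using Y(3)[OF t] by (metis bij_is_inj inv_f_f)
    then show ?thesis by (simp add: matrix_inv_cancel[OF inv])
  qed
  have "continuous_on {0..} (\<lambda>t. matrix_inv (\<Phi> 0) *v (inv (Y t) (g t)))"
    by (intro bounded_linear.continuous_on[OF matrix_vector_mul_bounded_linear]
        C_space_compose_continuous[OF Y(4)] continuous_on_id g) auto
  then show ?thesis by (rule continuous_on_eq) (simp add: eq)
qed

lemma integral_exp_decay_le:
  fixes \<alpha> t :: real
  assumes "\<alpha> > 0" "t \<ge> 0"
  shows "integral {0..t} (\<lambda>s. exp (- \<alpha> * (t - s))) \<le> 1 / \<alpha>"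
proof -
  have "exp (- \<alpha> * (t - s)) = exp (- \<alpha> * t) * exp (\<alpha> * s)" for s
    by (simp add: exp_add[symmetric] algebra_simps)
  then have "integral {0..t} (\<lambda>s. exp (- \<alpha> * (t - s))) = exp (- \<alpha> * t) * integral {0..t} (\<lambda>s. exp (\<alpha> * s))"
    by simp
  also have "\<dots> \<le> exp (- \<alpha> * t) * (exp (\<alpha> * t) / \<alpha>)"
    by (intro mult_left_mono integral_exp_le assms) simp
  also have "\<dots> = 1 / \<alpha>" by (simp add: exp_minus)
  finally show ?thesis .
qed

text \<open>The curve \<open>?v\<close>, the solution \<open>x\<close> plus \<open>\<Phi> t\<close>
  applied to the integral of \<open>?p\<close>, solves the inhomogeneous equation with the initial
  value of \<open>y\<close>; uniqueness gives \<open>y t = ?v t\<close>.\<close>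

lemma variation_of_constants:
  fixes A :: "real \<Rightarrow> real ^ 'n ^ 'n"
  assumes \<Phi>: "fundamental_matrix {0..} A \<Phi>" and A: "continuous_on {0..} A"
    and lip: "\<And>t x y. t \<ge> 0 \<Longrightarrow> norm (A t *v x - A t *v y) \<le> L * norm (x - y)" and L: "L > 0"
    and g: "continuous_on {0..} g"
    and x: "is_solution {0..} (linear_system A) x"
    and y: "is_solution {0..} (\<lambda>t z. A t *v z + g t) y"
    and init: "x 0 = y 0" and t: "t \<ge> 0"
  shows "((\<lambda>s. transition_matrix \<Phi> t s *v g s) has_integral (y t - x t)) {0..t}"
proof -
  let ?p = "\<lambda>s. matrix_inv (\<Phi> s) *v g s"
  have p: "continuous_on {0..} ?p"
    by (rule continuous_on_matrix_inv_fundamental[OF \<Phi> A lip L g])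
  let ?v = "\<lambda>t. x t + \<Phi> t *v integral {0..t} ?p"
  have v: "is_solution {0..} (\<lambda>t z. A t *v z + g t) ?v"
    unfolding is_solution_def
  proof
    fix t :: real assume t: "t \<in> {0..}"
    have \<Phi>t: "(\<Phi> has_vector_derivative A t ** \<Phi> t) (at t within {0..})" "invertible (\<Phi> t)"
      using \<Phi> t by (auto simp: fundamental_matrix_def)
    have "(?v has_vector_derivative A t *v x t +
      (\<Phi> t *v ?p t + (A t ** \<Phi> t) *v integral {0..t} ?p)) (at t within {0..})"
      using x t unfolding is_solution_def linear_system_def
      by (intro has_vector_derivative_add bounded_bilinear.has_vector_derivative[OF bounded_bilinear_matrix_vector_mult]
          \<Phi>t integral_has_vector_derivative_atLeast[OF p]) auto
    moreover have "A t *v x t + (\<Phi> t *v ?p t + (A t ** \<Phi> t) *v integral {0..t} ?p) = A t *v ?v t + g t"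
      by (simp add: matrix_inv_cancel[OF \<Phi>t(2)] matrix_vector_right_distrib matrix_vector_mul_assoc[symmetric])
    ultimately show "(?v has_vector_derivative A t *v ?v t + g t) (at t within {0..})" by simp
  qed
  have "y t = ?v t"
    by (rule lipschitz_solution_unique[OF _ y v _ t, where L = L]) (use lip init in auto)
  then have eq: "y t - x t = \<Phi> t *v integral {0..t} ?p" by simp
  have "(?p has_integral integral {0..t} ?p) {0..t}"
    by (intro integrable_integral integrable_continuous_real continuous_on_subset[OF p]) auto
  from has_integral_linear[OF this matrix_vector_mul_bounded_linear[of "\<Phi> t"]]
  show ?thesis by (simp add: eq o_def transition_matrix_def matrix_vector_mul_assoc)
qed

theorem theorem3p2:
  fixes r :: nat
    and nm :: "real ^ 'n \<Rightarrow> real"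
    and A :: "real \<Rightarrow> real ^ 'n ^ 'n"
    and f :: "real \<Rightarrow> real ^ 'n \<Rightarrow> real ^ 'n"
    and \<Phi> :: "real \<Rightarrow> real ^ 'n ^ 'n"
    and M \<mu> \<gamma> K \<alpha> :: real
  assumes r: "r \<ge> 1"
    and nm: "is_norm nm"
    and A_cont: "continuous_on {0..} A"
    and f_cont: "continuous_on ({0..} \<times> UNIV) (\<lambda>(t, y). f t y)"
    and \<Phi>: "fundamental_matrix {0..} A \<Phi>"
    and A1: "bdd_above ((\<lambda>t. operator_norm nm (A t)) ` {0..})"
      "(SUP t\<in>{0..}. operator_norm nm (A t)) = M"
    and A2: "\<mu> > 0" "\<And>t y. t \<ge> 0 \<Longrightarrow> nm (f t y) \<le> \<mu>"
    and A3: "\<gamma> > 0" "\<And>t y y'. t \<ge> 0 \<Longrightarrow> nm (f t y - f t y') \<le> \<gamma> * nm (y - y')"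
    and A4: "K > 0" "\<alpha> > 0"
      "\<And>t s. s \<ge> 0 \<Longrightarrow> t \<ge> s \<Longrightarrow>
         operator_norm nm (transition_matrix \<Phi> t s) \<le> K * exp (- \<alpha> * (t - s))"
      "2 * K * \<gamma> < \<alpha>"
    and D4: "space_derivs_continuous r {0..} f"
  shows "C_continuously_topologically_equivalent r {0..} (linear_system A) (perturbed_system A f)"
proof -
  obtain c C where c: "c > 0" "C > 0" "\<And>x. norm x \<le> c * nm x" "\<And>x. nm x \<le> C * norm x"
    using is_norm_equivalent[OF nm] by blast
  have nn: "nm x \<ge> 0" for x using nm by (simp add: is_norm_def)
  \<comment> \<open>In the norm \<open>nm\<close> both fields have the Lipschitz constant
    \<open>\<bar>M\<bar> + \<gamma>\<close>; the factors \<open>c\<close> and \<open>C\<close> carry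
    it over to the Euclidean norm.\<close>
  define L where "L = c * (\<bar>M\<bar> + \<gamma>) * C"
  have L: "L > 0" using c(1,2) A3(1) by (simp add: L_def add_nonneg_pos)
  have A_lip_nm: "nm (A t *v x) \<le> \<bar>M\<bar> * nm x" if "t \<ge> 0" for t x
  proof -
    have "operator_norm nm (A t) \<le> M"
      using cSUP_upper[OF _ A1(1), of t] A1(2) that by simp
    then have "operator_norm nm (A t) * nm x \<le> \<bar>M\<bar> * nm x" using nn by (intro mult_right_mono) auto
    with operator_norm_bound[OF nm, of "A t" x] show ?thesis by linarith
  qed
  have lipL: "norm z \<le> L * norm w" if "nm z \<le> (\<bar>M\<bar> + \<gamma>) * nm w" for z w
  proof -
    have "norm z \<le> c * nm z" by (rule c(3))
    also have "\<dots> \<le> c * ((\<bar>M\<bar> + \<gamma>) * nm w)" using c(1) that by (intro mult_left_mono) auto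
    also have "\<dots> \<le> c * ((\<bar>M\<bar> + \<gamma>) * (C * norm w))" using c(1,4) A3(1) by (intro mult_left_mono) auto
    finally show ?thesis by (simp add: L_def mult_ac)
  qed
  have lip1: "norm (A t *v x - A t *v y) \<le> L * norm (x - y)" if "t \<ge> 0" for t x y
  proof (rule lipL)
    have "nm (A t *v (x - y)) \<le> \<bar>M\<bar> * nm (x - y)" by (rule A_lip_nm[OF that])
    also have "\<dots> \<le> (\<bar>M\<bar> + \<gamma>) * nm (x - y)" using A3(1) nn by (intro mult_right_mono) auto
    finally show "nm (A t *v x - A t *v y) \<le> (\<bar>M\<bar> + \<gamma>) * nm (x - y)"
      by (simp add: matrix_vector_mult_diff_distrib)
  qed
  have lip2: "norm (perturbed_system A f t x - perturbed_system A f t y) \<le> L * norm (x - y)" if "t \<ge> 0" for t x y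
  proof (rule lipL)
    have "perturbed_system A f t x - perturbed_system A f t y = A t *v (x - y) + (f t x - f t y)"
      by (simp add: perturbed_system_def matrix_vector_mult_diff_distrib)
    then have "nm (perturbed_system A f t x - perturbed_system A f t y) \<le> nm (A t *v (x - y)) + nm (f t x - f t y)"
      using nm by (simp add: is_norm_def)
    also have "\<dots> \<le> \<bar>M\<bar> * nm (x - y) + \<gamma> * nm (x - y)"
      by (intro add_mono A_lip_nm A3(2) that)
    finally show "nm (perturbed_system A f t x - perturbed_system A f t y) \<le> (\<bar>M\<bar> + \<gamma>) * nm (x - y)"
      by (simp add: algebra_simps)
  qed
  have f_smooth: "C_space r {0..} f" using D4 by (simp add: C_space_iff_space_derivs_continuous)
  have smooth: "C_space r {0..} (perturbed_system A f)"
    by (rule C_space_cong[OF C_space_add[OF C_space_linear_system[OF A_cont] f_smooth]])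
      (simp add: perturbed_system_def linear_system_def)
  show ?thesis
  proof (rule C_equivalence_of_lipschitz_systems[OF C_space_linear_system[OF A_cont] smooth L _ lip2])
    fix x y and t :: real
    assume x: "is_solution {0..} (linear_system A) x" and y: "is_solution {0..} (perturbed_system A f) y"
      and init: "x 0 = y 0" and t: "t \<ge> 0"
    let ?g = "\<lambda>s. f s (y s)"
    have g: "continuous_on {0..} ?g"
      by (rule C_space_compose_continuous[OF f_smooth]) (auto intro!: is_solution_continuous_on[OF y])
    \<comment> \<open>Along the fixed solution \<open>y\<close> the nonlinear term is a known
      forcing, so (N) becomes an inhomogeneous linear equation.\<close>
    have "is_solution {0..} (\<lambda>t z. A t *v z + ?g t) y"
      using y by (simp add: is_solution_def perturbed_system_def)
    from variation_of_constants[OF \<Phi> A_cont lip1 L g x this init t]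
    have int: "((\<lambda>s. transition_matrix \<Phi> t s *v ?g s) has_integral (y t - x t)) {0..t}" .
    \<comment> \<open>In the majorant \<open>c\<close> passes to the Euclidean norm,
      \<open>K * exp (- \<alpha> * (t - s))\<close> bounds the transition matrix and
      \<open>\<mu>\<close> bounds \<open>f\<close>. The exponential integrates to at most
      \<open>1 / \<alpha>\<close> for every \<open>t\<close>.\<close>
    have "norm (integral {0..t} (\<lambda>s. transition_matrix \<Phi> t s *v ?g s)) \<le>
      integral {0..t} (\<lambda>s. (c * K * \<mu>) * exp (- \<alpha> * (t - s)))"
    proof (rule integral_norm_bound_integral)
      show "(\<lambda>s. transition_matrix \<Phi> t s *v ?g s) integrable_on {0..t}" using int by blast
      show "(\<lambda>s. (c * K * \<mu>) * exp (- \<alpha> * (t - s))) integrable_on {0..t}"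
        by (intro integrable_continuous_real continuous_intros)
      fix s assume s: "s \<in> {0..t}"
      let ?X = "transition_matrix \<Phi> t s"
      have "norm (?X *v ?g s) \<le> c * nm (?X *v ?g s)" by (rule c(3))
      also have "\<dots> \<le> c * (operator_norm nm ?X * nm (?g s))"
        using c(1) by (intro mult_left_mono operator_norm_bound[OF nm]) auto
      also have "\<dots> \<le> c * ((K * exp (- \<alpha> * (t - s))) * \<mu>)"
        using c(1) s A4(1) nn by (intro mult_left_mono mult_mono A4(3) A2(2)) auto
      finally show "norm (?X *v ?g s) \<le> (c * K * \<mu>) * exp (- \<alpha> * (t - s))" by (simp add: mult_ac)
    qed
    also have "\<dots> = (c * K * \<mu>) * integral {0..t} (\<lambda>s. exp (- \<alpha> * (t - s)))" by simp
    also have "\<dots> \<le> (c * K * \<mu>) * (1 / \<alpha>)"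
      using c(1) A2(1) A4(1,2) t by (intro mult_left_mono integral_exp_decay_le) auto
    finally show "norm (y t - x t) \<le> (c * K * \<mu>) * (1 / \<alpha>)"
      by (simp only: integral_unique[OF int])
  qed (use lip1 in \<open>simp add: linear_system_def\<close>)
qed

end
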